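(* There is an absolute constant $c>0$ such that for every connected planar graph $G$ with $N$ vertices and every routing that sends one unit of flow between each unordered pair of distinct vertices of $G$ along paths in $G$ (not necessarily shortest paths), the maximum vertex flow $M_v$ satisfies $$c\,N^{3/2}\le M_v\le \frac{N(N-1)}{2}.$$ In particular $M_v$ lies between order $N^{3/2}$ and order $N^2$.
   Context: For a routing on a finite connected graph $G$ in which one unit of flow is sent between each unordered pair of distinct vertices (possibly split among several paths), the vertex flow $T(u)$ of a vertex $u$ is the total amount of flow, over all pairs (including pairs having $u$ as an endpoint), passing through $u$; the maximum vertex flow is $M_v=\max_u T(u)$.
   Formalization: The formal theorem assumes N ≥ 2, because for the one-vertex graph M_v = 0 and the lower bound c·N^{3/2} ≤ M_v fails; vertices are taken to be natural numbers, which covers every finite graph up to isomorphism. *)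

theory Defs
  imports "HOL-Analysis.Analysis"
begin

definition simple_graph :: "'a set \<Rightarrow> ('a \<Rightarrow> 'a \<Rightarrow> bool) \<Rightarrow> bool" where
  "simple_graph V E \<longleftrightarrow> finite V \<and> (\<forall>x y. E x y \<longrightarrow> x \<in> V \<and> y \<in> V)
     \<and> (\<forall>x y. E x y \<longrightarrow> E y x) \<and> (\<forall>x. \<not> E x x)"

definition connected_graph :: "'a set \<Rightarrow> ('a \<Rightarrow> 'a \<Rightarrow> bool) \<Rightarrow> bool" where
  "connected_graph V E \<longleftrightarrow> (\<forall>u\<in>V. \<forall>v\<in>V. E\<^sup>*\<^sup>* u v)"

definition planar_graph :: "'a set \<Rightarrow> ('a \<Rightarrow> 'a \<Rightarrow> bool) \<Rightarrow> bool" where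
  "planar_graph V E \<longleftrightarrow> (\<exists>(pos :: 'a \<Rightarrow> complex) (\<gamma> :: 'a \<Rightarrow> 'a \<Rightarrow> real \<Rightarrow> complex).
      inj_on pos V
    \<and> (\<forall>u v. E u v \<longrightarrow> arc (\<gamma> u v) \<and> pathstart (\<gamma> u v) = pos u \<and> pathfinish (\<gamma> u v) = pos v
                      \<and> \<gamma> v u = reversepath (\<gamma> u v))
    \<and> (\<forall>u v w. E u v \<and> w \<in> V \<and> w \<noteq> u \<and> w \<noteq> v \<longrightarrow> pos w \<notin> path_image (\<gamma> u v))
    \<and> (\<forall>u v x y. E u v \<and> E x y \<and> {u, v} \<noteq> {x, y} \<longrightarrow>
         path_image (\<gamma> u v) \<inter> path_image (\<gamma> x y) \<subseteq> pos ` ({u, v} \<inter> {x, y})))"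

definition graph_path :: "'a set \<Rightarrow> ('a \<Rightarrow> 'a \<Rightarrow> bool) \<Rightarrow> 'a list \<Rightarrow> bool" where
  "graph_path V E p \<longleftrightarrow> distinct p \<and> 2 \<le> length p \<and> set p \<subseteq> V
     \<and> (\<forall>i. Suc i < length p \<longrightarrow> E (p ! i) (p ! Suc i))"

definition paths_of :: "'a set \<Rightarrow> ('a \<Rightarrow> 'a \<Rightarrow> bool) \<Rightarrow> 'a list set" where
  "paths_of V E = {p. graph_path V E p}"

definition routing :: "'a set \<Rightarrow> ('a \<Rightarrow> 'a \<Rightarrow> bool) \<Rightarrow> ('a list \<Rightarrow> real) \<Rightarrow> bool" where
  "routing V E r \<longleftrightarrow> (\<forall>p. 0 \<le> r p) \<and> (\<forall>p. r p \<noteq> 0 \<longrightarrow> graph_path V E p)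
     \<and> (\<forall>u\<in>V. \<forall>v\<in>V. u \<noteq> v \<longrightarrow>
          (\<Sum>p\<in>{p\<in>paths_of V E. (hd p = u \<and> last p = v) \<or> (hd p = v \<and> last p = u)}. r p) = 1)"

definition vertex_flow :: "'a set \<Rightarrow> ('a \<Rightarrow> 'a \<Rightarrow> bool) \<Rightarrow> ('a list \<Rightarrow> real) \<Rightarrow> 'a \<Rightarrow> real" where
  "vertex_flow V E r w = (\<Sum>p\<in>{p\<in>paths_of V E. w \<in> set p}. r p)"

definition max_vertex_flow :: "'a set \<Rightarrow> ('a \<Rightarrow> 'a \<Rightarrow> bool) \<Rightarrow> ('a list \<Rightarrow> real) \<Rightarrow> real" where
  "max_vertex_flow V E r = Max (vertex_flow V E r ` V)"

end

theory Submission
  imports Defs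
begin

text \<open>
  The lower bound is a crossing-number argument. Place the 15 vertices of the once subdivided
  \<open>K\<^sub>3\<^sub>,\<^sub>3\<close> injectively at random on \<open>V\<close> and draw each of its 18 edges along a random path of the
  routing. If the paths of independent edges were always vertex-disjoint, the paths leaving the
  six branch vertices would form a \<open>K\<^sub>3\<^sub>,\<^sub>3\<close> minor, which a plane graph does not have. Hence some
  independent pair meets, and a union bound gives \<open>N^15 = O(N^11 \<Sum>\<^sub>w T(w)\<^sup>2) = O(N^12 M\<^sup>2)\<close>.
  Subdividing is essential: paths with a common branch vertex may meet anywhere, since they lie in
  the same branch set, and two paths with a common subdivision vertex may be cut where they first
  meet, so intersections of adjacent edges, which are too frequent to be counted, do no harm.

  A \<open>K\<^sub>3\<^sub>,\<^sub>3\<close> minor contains a theta graph (through two of the branch sets on one side) whose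
  complement has a component touching the interior of all three arms; this contradicts the
  Jordan curve theorem.
\<close>

subsection \<open>Theta curves in the plane\<close>

lemma connected_subset_inside_or_outside:
  fixes J :: "complex set"
  assumes "closed J" "connected C" "C \<inter> J = {}"
  shows "C \<subseteq> inside J \<or> C \<subseteq> outside J"
proof -
  have "C \<subseteq> inside J \<union> outside J"
    using assms(3) inside_Un_outside[of J] by blast
  moreover have "open (inside J)" "open (outside J)"
    using assms(1) by (auto intro: open_inside open_outside)
  moreover have "inside J \<inter> outside J \<inter> C = {}"
    using inside_Int_outside by auto
  ultimately have "inside J \<inter> C = {} \<or> outside J \<inter> C = {}"
    using connectedD[OF assms(2)] by blast
  with \<open>C \<subseteq> inside J \<union> outside J\<close> show ?thesis by blast
qed

locale theta_curve =
  fixes c1 c2 c3 :: "real \<Rightarrow> complex" and a b :: complex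
  assumes arcs: "arc c1" "arc c2" "arc c3"
    and starts: "pathstart c1 = a" "pathstart c2 = a" "pathstart c3 = a"
    and finishes: "pathfinish c1 = b" "pathfinish c2 = b" "pathfinish c3 = b"
    and meets: "path_image c1 \<inter> path_image c2 = {a, b}"
      "path_image c1 \<inter> path_image c3 = {a, b}"
      "path_image c2 \<inter> path_image c3 = {a, b}"
begin

lemma ends_distinct: "a \<noteq> b"
  using arcs(1) starts(1) finishes(1) arc_distinct_ends by blast

lemma closed_images:
  "closed (path_image c1)" "closed (path_image c2)" "closed (path_image c3)"
  using arcs by (auto intro: closed_path_image arc_imp_path)

text \<open>The arc \<open>c3\<close> is a chord of the Jordan curve \<open>c1\<close> with
  \<open>c2\<close>, so it splits the inside into a face bounded by \<open>c1\<close> and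
  \<open>c3\<close> and a face bounded by \<open>c2\<close> and \<open>c3\<close>. The set
  \<open>C\<close> lies in one of these faces or outside the curve. The closures of the two faces
  miss the interiors of \<open>c2\<close> and \<open>c1\<close> respectively, and the outside cannot
  accumulate at \<open>w3\<close>, which lies in the open inside.\<close>

lemma no_common_face_if_inside:
  assumes c3_inside: "path_image c3 \<inter> inside (path_image c1 \<union> path_image c2) \<noteq> {}"
    and C: "connected C" "C \<inter> (path_image c1 \<union> path_image c2 \<union> path_image c3) = {}"
    and w1: "w1 \<in> closure C" "w1 \<in> path_image c1 - {a, b}"
    and w2: "w2 \<in> closure C" "w2 \<in> path_image c2 - {a, b}"
    and w3: "w3 \<in> closure C" "w3 \<in> path_image c3 - {a, b}"
  shows False
proof -
  define J where "J = path_image c1 \<union> path_image c2"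
  define I1 where "I1 = inside (path_image c1 \<union> path_image c3)"
  define I2 where "I2 = inside (path_image c2 \<union> path_image c3)"
  have disj: "I1 \<inter> I2 = {}" and split: "I1 \<union> I2 \<union> (path_image c3 - {a, b}) = inside J"
    using split_inside_simple_closed_curve[of c1 a b c2 c3] arcs starts finishes meets
      c3_inside ends_distinct
    unfolding I1_def I2_def J_def by (metis arc_imp_simple_path)+
  have clJ: "closed J" unfolding J_def using closed_images by auto
  have op: "open I1" "open I2" "closure I1 \<subseteq> path_image c1 \<union> path_image c3 \<union> I1"
    "closure I2 \<subseteq> path_image c2 \<union> path_image c3 \<union> I2"
    unfolding I1_def I2_def using closed_images
    by (auto intro!: open_inside closure_inside_subset)
  have CJ: "C \<inter> J = {}" using C(2) J_def by auto
  consider "C \<subseteq> inside J" | "C \<subseteq> outside J"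
    using connected_subset_inside_or_outside[OF clJ C(1) CJ] by blast
  then show False
  proof cases
    case 1
    have "C \<subseteq> I1 \<union> I2" using 1 split C(2) by blast
    then have "C \<subseteq> I1 \<or> C \<subseteq> I2"
      using connectedD[OF C(1) op(1,2)] disj by blast
    then show False
    proof
      assume "C \<subseteq> I1"
      then have "w2 \<in> path_image c1 \<union> path_image c3 \<union> I1"
        using w2(1) op(3) closure_mono by blast
      moreover have "w2 \<notin> inside J" using w2(2) inside_no_overlap[of J] unfolding J_def by blast
      ultimately show False using w2(2) meets split by blast
    next
      assume "C \<subseteq> I2"
      then have "w1 \<in> path_image c2 \<union> path_image c3 \<union> I2"
        using w1(1) op(4) closure_mono by blast
      moreover have "w1 \<notin> inside J" using w1(2) inside_no_overlap[of J] unfolding J_def by blast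
      ultimately show False using w1(2) meets split by blast
    qed
  next
    case 2
    have "w3 \<in> inside J" using w3(2) split by blast
    then have "inside J \<inter> C \<noteq> {}"
      using w3(1) open_inside[OF clJ] by (auto simp: closure_iff_nhds_not_empty)
    then show False using 2 inside_Int_outside[of J] by blast
  qed
qed

text \<open>On the sphere, inside and outside of the curve formed by \<open>c1\<close> and
  \<open>c2\<close> are interchangeable. A chord outside is therefore moved inside by an inversion,
  which reduces the claim to the preceding case.\<close>

lemma no_common_face:
  assumes C: "connected C" "C \<inter> (path_image c1 \<union> path_image c2 \<union> path_image c3) = {}"
    and w1: "w1 \<in> closure C" "w1 \<in> path_image c1 - {a, b}"
    and w2: "w2 \<in> closure C" "w2 \<in> path_image c2 - {a, b}"
    and w3: "w3 \<in> closure C" "w3 \<in> path_image c3 - {a, b}"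
  shows False
proof (cases "path_image c3 \<inter> inside (path_image c1 \<union> path_image c2) = {}")
  case False
  then show False using no_common_face_if_inside assms by blast
next
  case c3_outside: True
  define J where "J = path_image c1 \<union> path_image c2"
  have clJ: "closed J" unfolding J_def using closed_images by auto
  have CJ: "C \<inter> J = {}" using C(2) J_def by auto
  have w3J: "w3 \<notin> J" using w3(2) meets J_def by auto
  have w3I: "w3 \<notin> inside J" using w3(2) c3_outside J_def by auto
  have CO: "C \<subseteq> outside J"
  proof (rule ccontr)
    assume "\<not> C \<subseteq> outside J"
    then have "C \<subseteq> inside J"
      using connected_subset_inside_or_outside[OF clJ C(1) CJ] by blast
    then have "w3 \<in> J \<union> inside J"
      using w3(1) closure_inside_subset[OF clJ] closure_mono by blast
    then show False using w3J w3I by blast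
  qed
  have loop: "simple_path (c1 +++ reversepath c2)"
    using arcs starts finishes meets
    by (simp add: simple_path_join_loop_eq arc_reversepath)
  have "path_image (c1 +++ reversepath c2) = J"
    using starts finishes J_def by (simp add: path_image_join)
  then have "inside J \<noteq> {}"
    using Jordan_inside_outside[OF loop] starts finishes by simp
  then obtain z where z: "z \<in> inside J" by blast
  then obtain \<epsilon> where \<epsilon>: "\<epsilon> > 0" "ball z \<epsilon> \<subseteq> inside J"
    using open_inside[OF clJ] open_contains_ball by metis
  have zJ: "z \<notin> J" using z inside_no_overlap by blast
  have z3: "z \<notin> path_image c3" using z c3_outside J_def by blast
  \<comment> \<open>The inversion is discontinuous at \<open>z\<close>. Keeping \<open>z\<close> off
    the closure of \<open>C\<close> makes it continuous there, so that the limit points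
    \<open>w1\<close>, \<open>w2\<close>, \<open>w3\<close> of \<open>C\<close> go to limit points
    of the image.\<close>
  have zC: "z \<notin> closure C"
  proof
    assume "z \<in> closure C"
    then have "inside J \<inter> C \<noteq> {}"
      using z open_inside[OF clJ] by (auto simp: closure_iff_nhds_not_empty)
    then show False using CO inside_Int_outside[of J] by blast
  qed
  \<comment> \<open>Inversion about a point inside \<open>J\<close> turns \<open>c3\<close> into a chord inside the image of \<open>J\<close>.\<close>
  define h where "h = (\<lambda>w. inverse (w - z))"
  define k where "k = (\<lambda>u. z + inverse u)"
  \<comment> \<open>Since \<open>inverse 0 = 0\<close>, both identities hold without exception:
    \<open>h z = 0\<close> and \<open>k 0 = z\<close>. So \<open>h\<close> is injective on the whole
    plane, and only its continuity fails at \<open>z\<close>.\<close>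
  have kh: "k (h w) = w" for w by (simp add: h_def k_def)
  have hk: "h (k u) = u" for u by (simp add: h_def k_def)
  have inj: "inj h" by (metis injI kh)
  have conth: "continuous_on S h" if "z \<notin> S" for S
    unfolding h_def using that by (intro continuous_intros) auto
  have arc_h: "arc (h \<circ> c)" if "arc c" "z \<notin> path_image c" for c
    using that conth[of "path_image c"] inj
    by (auto simp: arc_def path_image_def intro!: path_continuous_image comp_inj_on
        intro: inj_on_subset)
  interpret inv: theta_curve "h \<circ> c1" "h \<circ> c2" "h \<circ> c3" "h a" "h b"
  proof
    show "arc (h \<circ> c1)" "arc (h \<circ> c2)" "arc (h \<circ> c3)"
      using arc_h arcs zJ z3 J_def by auto
    show "path_image (h \<circ> c1) \<inter> path_image (h \<circ> c2) = {h a, h b}"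
      "path_image (h \<circ> c1) \<inter> path_image (h \<circ> c3) = {h a, h b}"
      "path_image (h \<circ> c2) \<inter> path_image (h \<circ> c3) = {h a, h b}"
      using meets by (simp_all add: path_image_compose image_Int[OF inj, symmetric])
  qed (use starts finishes in \<open>simp_all add: pathstart_compose pathfinish_compose\<close>)
  have mem: "h w \<in> path_image (h \<circ> c) - {h a, h b}" if "w \<in> path_image c - {a, b}" for w c
    using that inj by (auto simp: path_image_compose dest: injD)
  have cl: "h w \<in> closure (h ` C)" if "w \<in> closure C" for w
    using continuous_image_closure_subset[OF conth[OF zC], of C] that closure_subset by blast
  have clJ': "closed (h ` J)"
    using inv.closed_images(1,2) unfolding J_def path_image_compose image_Un by (rule closed_Un)
  have "h w3 \<in> inside (h ` J)"
  proof -
    \<comment> \<open>To show: \<open>K\<close> is bounded. Pulled back by \<open>k\<close>, it lies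
      outside \<open>J\<close> and hence avoids the ball of radius \<open>\<epsilon>\<close> about
      \<open>z\<close>, which bounds the norm on \<open>K\<close> by
      \<open>1 / \<epsilon>\<close>.\<close>
    define K where "K = connected_component_set (- (h ` J)) (h w3)"
    have opK: "open K" unfolding K_def using clJ' by (intro open_connected_component) auto
    have w3K: "h w3 \<in> K" unfolding K_def
      using w3J inj by (auto simp: connected_component_refl_eq dest: injD)
    have h_w3: "h w3 \<noteq> 0" using z3 w3(2) by (auto simp: h_def)
    \<comment> \<open>The point 0 corresponds to infinity and is a discontinuity of
      \<open>k\<close>; removing one point does not disconnect an open connected set in the
      plane.\<close>
    have "connected (K - {0})"
      using opK by (intro connected_open_delete) (auto simp: K_def)
    then have conn: "connected (k ` (K - {0}))"
      by (intro connected_continuous_image) (auto simp: k_def intro!: continuous_intros)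
    have "u \<notin> h ` J" if "u \<in> K" for u
      using that connected_component_subset unfolding K_def by fastforce
    then have "k u \<notin> J" if "u \<in> K" for u using that hk[of u] by (metis imageI)
    then have kJ: "k ` (K - {0}) \<inter> J = {}" by blast
    have "w3 \<in> k ` (K - {0})" using w3K h_w3 kh by (metis DiffI image_eqI singletonD)
    then have kO: "k ` (K - {0}) \<subseteq> outside J"
      using connected_subset_inside_or_outside[OF clJ conn kJ] w3I by blast
    have "norm u \<le> 1 / \<epsilon>" if "u \<in> K" for u
    proof (cases "u = 0")
      case False
      then have "k u \<notin> ball z \<epsilon>"
        using kO that \<epsilon>(2) inside_Int_outside[of J] by blast
      then have "\<epsilon> \<le> inverse (norm u)" by (simp add: k_def dist_norm norm_inverse)
      then show ?thesis using False \<epsilon>(1) by (simp add: field_simps)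
    qed (use \<epsilon> in auto)
    then have "bounded K" by (auto simp: bounded_iff)
    then show ?thesis
      unfolding inside_def K_def using w3J inj by (auto dest: injD)
  qed
  then have "path_image (h \<circ> c3) \<inter> inside (path_image (h \<circ> c1) \<union> path_image (h \<circ> c2)) \<noteq> {}"
    using w3(2) J_def by (auto simp: path_image_compose image_Un)
  moreover have "connected (h ` C)"
    using C(1) conth zC closure_subset by (blast intro: connected_continuous_image)
  moreover have "h ` C \<inter> (path_image (h \<circ> c1) \<union> path_image (h \<circ> c2) \<union> path_image (h \<circ> c3)) = {}"
    using C(2) inj by (auto simp: path_image_compose dest: injD)
  ultimately show False
    using inv.no_common_face_if_inside[of "h ` C" "h w1" "h w2" "h w3"]
      cl mem w1 w2 w3 by blast
qed

end

subsection \<open>Plane graphs have no \<open>K\<^sub>3\<^sub>,\<^sub>3\<close> minor\<close>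

definition connected_in :: "('a \<Rightarrow> 'a \<Rightarrow> bool) \<Rightarrow> 'a set \<Rightarrow> bool" where
  "connected_in E S \<longleftrightarrow> (\<forall>u\<in>S. \<forall>v\<in>S. (\<lambda>x y. E x y \<and> x \<in> S \<and> y \<in> S)\<^sup>*\<^sup>* u v)"

lemma rtranclp_imp_distinct_list:
  assumes "R\<^sup>*\<^sup>* u v"
  shows "\<exists>p. p \<noteq> [] \<and> hd p = u \<and> last p = v \<and> distinct p \<and> successively R p"
  using assms
proof (induction rule: rtranclp_induct)
  case base
  show ?case by (rule exI[of _ "[u]"]) auto
next
  case (step v w)
  then obtain p where p: "p \<noteq> []" "hd p = u" "last p = v" "distinct p" "successively R p"
    by blast
  show ?case
  proof (cases "w \<in> set p")
    \<comment> \<open>The walk returns to a visited vertex, so the list is cut at its earlier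
      occurrence.\<close>
    case True
    then obtain q r where "p = q @ w # r" by (meson split_list)
    then show ?thesis
      using p by (intro exI[of _ "q @ [w]"]) (auto simp: successively_append_iff hd_append)
  next
    case False
    then show ?thesis
      using p step(2) by (intro exI[of _ "p @ [w]"]) (auto simp: successively_append_iff)
  qed
qed

lemma successively_set_subset:
  assumes "successively (\<lambda>x y. E x y \<and> x \<in> S \<and> y \<in> S) p" "hd p \<in> S"
  shows "set p \<subseteq> S"
  using assms by (induction p rule: induct_list012) auto

lemma connected_in_obtain_path:
  assumes "connected_in E S" "u \<in> S" "v \<in> S"
  obtains p where "p \<noteq> []" "hd p = u" "last p = v" "distinct p" "successively E p" "set p \<subseteq> S"
proof -
  obtain p where p: "p \<noteq> []" "hd p = u" "last p = v" "distinct p"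
    "successively (\<lambda>x y. E x y \<and> x \<in> S \<and> y \<in> S) p"
    using assms rtranclp_imp_distinct_list unfolding connected_in_def by meson
  moreover have "successively E p"
    using p(5) by (rule successively_mono) auto
  ultimately show thesis
    using that successively_set_subset[OF p(5)] assms(2) by auto
qed

text \<open>Serves to stop a walk where it first enters a theta graph, or where it first leaves a
  branch set.\<close>

lemma rtranclp_first_hit:
  assumes "Q\<^sup>*\<^sup>* u v" "u \<notin> T" "v \<in> T"
  shows "\<exists>s w. (\<lambda>x y. Q x y \<and> y \<notin> T)\<^sup>*\<^sup>* u s \<and> Q s w \<and> w \<in> T"
proof -
  have "(\<lambda>x y. Q x y \<and> y \<notin> T)\<^sup>*\<^sup>* u v \<or> (\<exists>s w. (\<lambda>x y. Q x y \<and> y \<notin> T)\<^sup>*\<^sup>* u s \<and> Q s w \<and> w \<in> T)"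
    using assms(1)
  proof (induction rule: rtranclp_induct)
    case (step y z)
    then show ?case
      by (metis (no_types, lifting) rtranclp.rtrancl_into_rtrancl)
  qed simp
  then show ?thesis
    using assms(2,3) by (metis (no_types, lifting) rtranclp.cases)
qed

lemma less_3_cases: "(j::nat) < 3 \<Longrightarrow> j = 0 \<or> j = 1 \<or> j = 2"
  by auto

text \<open>Take a path \<open>p\<close> from \<open>s 0\<close> to \<open>s 1\<close> and follow a
  path from \<open>s 2\<close> until it first meets \<open>p\<close>. The meeting vertex is the
  centre \<open>x\<close>; any of the three legs may consist of \<open>x\<close> alone.\<close>

lemma connected_in_tripod:
  assumes conn: "connected_in E S" and sym: "\<And>x y. E x y \<Longrightarrow> E y x"
    and s: "\<And>j. j < 3 \<Longrightarrow> s j \<in> S"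
  obtains x X where "x \<in> S"
    and "\<And>j::nat. j < 3 \<Longrightarrow> X j \<noteq> [] \<and> hd (X j) = x \<and> last (X j) = s j \<and> distinct (X j)
        \<and> successively E (X j) \<and> set (X j) \<subseteq> S"
    and "\<And>j k. j < 3 \<Longrightarrow> k < 3 \<Longrightarrow> j \<noteq> k \<Longrightarrow> set (X j) \<inter> set (X k) = {x}"
proof -
  have s': "s 0 \<in> S" "s 1 \<in> S" "s 2 \<in> S" using s by auto
  obtain p where p: "p \<noteq> []" "hd p = s 0" "last p = s 1" "distinct p" "successively E p" "set p \<subseteq> S"
    using connected_in_obtain_path[OF conn s'(1,2)] .
  obtain q where q: "q \<noteq> []" "hd q = s 2" "last q = s 0" "distinct q" "successively E q" "set q \<subseteq> S"
    using connected_in_obtain_path[OF conn s'(3,1)] .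
  have "\<exists>v\<in>set q. v \<in> set p" using p q by (metis hd_in_set last_in_set)
  then obtain q1 x q2 where q12: "q = q1 @ x # q2" "x \<in> set p" "\<forall>v\<in>set q1. v \<notin> set p"
    using split_list_first_prop[of q "\<lambda>v. v \<in> set p"] by blast
  obtain p1 p2 where p12: "p = p1 @ x # p2" using q12(2) by (meson split_list)
  have symE: "successively (\<lambda>x y. E y x) l = successively E l" for l
    using sym by (auto elim: successively_mono)
  define X where "X = (\<lambda>j::nat. if j = 0 then x # rev p1 else if j = 1 then x # p2 else x # rev q1)"
  have X: "X 0 = rev (p1 @ [x])" "X 1 = x # p2" "X 2 = rev (q1 @ [x])" by (auto simp: X_def)
  show thesis
  proof
    show "x \<in> S" using q12 p by auto
    fix j k :: nat
    assume j: "j < 3"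
    show "X j \<noteq> [] \<and> hd (X j) = x \<and> last (X j) = s j \<and> distinct (X j)
        \<and> successively E (X j) \<and> set (X j) \<subseteq> S"
      using less_3_cases[OF j] p q unfolding p12 q12(1)
      by (elim disjE) (simp_all only: X successively_rev symE, auto simp: successively_append_iff hd_append last_rev split: if_splits)
    assume k: "k < 3" and jk: "j \<noteq> k"
    have "set p1 \<inter> set p2 = {}" "x \<notin> set p1" "x \<notin> set p2" "x \<notin> set q1"
      "set q1 \<inter> set p1 = {}" "set q1 \<inter> set p2 = {}"
      using p(4) q(4) q12(3) unfolding p12 q12(1) by auto
    then show "set (X j) \<inter> set (X k) = {x}"
      using less_3_cases[OF j] less_3_cases[OF k] jk
      by (elim disjE) (auto simp: X X(2)[unfolded One_nat_def])
  qed
qed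

section \<open>Drawings of paths and theta graphs in the plane\<close>

locale plane_drawing =
  fixes V :: "'a set" and E :: "'a \<Rightarrow> 'a \<Rightarrow> bool"
    and pos :: "'a \<Rightarrow> complex" and \<gamma> :: "'a \<Rightarrow> 'a \<Rightarrow> real \<Rightarrow> complex"
  assumes edge_in: "E x y \<Longrightarrow> x \<in> V \<and> y \<in> V" and sym: "E x y \<Longrightarrow> E y x"
    and inj_pos: "inj_on pos V"
    and edge_arc: "E u v \<Longrightarrow> arc (\<gamma> u v) \<and> pathstart (\<gamma> u v) = pos u \<and> pathfinish (\<gamma> u v) = pos v"
    and vertex_off_edge: "E u v \<Longrightarrow> w \<in> V \<Longrightarrow> w \<noteq> u \<Longrightarrow> w \<noteq> v \<Longrightarrow> pos w \<notin> path_image (\<gamma> u v)"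
    and edges_cross: "E u v \<Longrightarrow> E x y \<Longrightarrow> {u, v} \<noteq> {x, y} \<Longrightarrow>
         path_image (\<gamma> u v) \<inter> path_image (\<gamma> x y) \<subseteq> pos ` ({u, v} \<inter> {x, y})"
begin

text \<open>For a list with a single vertex this is empty and does not contain the position of that
  vertex, hence the length conditions below.\<close>

definition trace :: "'a list \<Rightarrow> complex set" where
  "trace p = (\<Union>(x, y)\<in>set (zip p (tl p)). path_image (\<gamma> x y))"

lemma trace_Cons_Cons: "trace (u # v # p) = path_image (\<gamma> u v) \<union> trace (v # p)"
  by (simp add: trace_def)

lemma ends_in_edge: "E u v \<Longrightarrow> pos u \<in> path_image (\<gamma> u v) \<and> pos v \<in> path_image (\<gamma> u v)"
  using edge_arc[of u v] by (metis pathstart_in_path_image pathfinish_in_path_image)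

lemma zip_tl_edge:
  assumes "successively E p" "(x, y) \<in> set (zip p (tl p))"
  shows "E x y" "x \<in> set p" "y \<in> set p"
  using assms by (induction p rule: induct_list012) auto

text \<open>Because the end \<open>s\<close> is off \<open>p\<close>, the edge differs from every
  edge of \<open>p\<close>, and distinct edges meet only at shared ends.\<close>

lemma edge_Int_trace:
  assumes "E s t" "s \<notin> set p" "successively E p"
  shows "path_image (\<gamma> s t) \<inter> trace p \<subseteq> pos ` ({t} \<inter> set p)"
proof
  fix z assume z: "z \<in> path_image (\<gamma> s t) \<inter> trace p"
  then obtain x y where xy: "(x, y) \<in> set (zip p (tl p))" "z \<in> path_image (\<gamma> x y)"
    by (auto simp: trace_def)
  have *: "E x y" "x \<in> set p" "y \<in> set p" using zip_tl_edge[OF assms(3) xy(1)] by auto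
  then have "{s, t} \<noteq> {x, y}" using assms(2) by auto
  then have "z \<in> pos ` ({s, t} \<inter> {x, y})" using edges_cross[OF assms(1) *(1)] z xy by blast
  then show "z \<in> pos ` ({t} \<inter> set p)" using * assms(2) by auto
qed

lemma vertex_notin_trace:
  assumes "w \<in> V" "w \<notin> set p" "successively E p"
  shows "pos w \<notin> trace p"
proof
  assume "pos w \<in> trace p"
  then obtain x y where xy: "(x, y) \<in> set (zip p (tl p))" "pos w \<in> path_image (\<gamma> x y)"
    by (auto simp: trace_def)
  have "E x y" "x \<in> set p" "y \<in> set p" using zip_tl_edge[OF assms(3) xy(1)] by auto
  then show False using vertex_off_edge[of x y w] assms xy by auto
qed

text \<open>The edge arcs are joined one by one. By distinctness the first vertex is not on the rest
  of the list, so its edge meets the remaining arc only at their common vertex.\<close>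

lemma trace_arc:
  assumes "distinct p" "successively E p" "2 \<le> length p"
  shows "(\<exists>g. arc g \<and> pathstart g = pos (hd p) \<and> pathfinish g = pos (last p) \<and> path_image g = trace p)
    \<and> pos ` set p \<subseteq> trace p"
  using assms
proof (induction p rule: induct_list012)
  case (3 u v p)
  have E: "E u v" using 3 by simp
  show ?case
  proof (cases p)
    case Nil
    then show ?thesis using edge_arc[OF E] ends_in_edge[OF E] by (auto simp: trace_def)
  next
    case (Cons w r)
    then obtain g where g: "arc g" "pathstart g = pos v" "pathfinish g = pos (last (v # p))"
      "path_image g = trace (v # p)" "pos ` set (v # p) \<subseteq> trace (v # p)"
      using 3 by fastforce
    have "path_image (\<gamma> u v) \<inter> path_image g \<subseteq> pos ` ({v} \<inter> set (v # p))"
      using edge_Int_trace[OF E, of "v # p"] 3 g by auto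
    then have "arc (\<gamma> u v +++ g)"
      using g edge_arc[OF E] by (intro arc_join) auto
    moreover have "path_image (\<gamma> u v +++ g) = trace (u # v # p)"
      using g edge_arc[OF E] by (simp add: path_image_join trace_Cons_Cons)
    ultimately show ?thesis
      using g edge_arc[OF E] ends_in_edge[OF E]
      by (intro conjI exI[of _ "\<gamma> u v +++ g"]) (auto simp: trace_Cons_Cons)
  qed
qed auto

text \<open>The interior vertex \<open>v\<close> rules out that \<open>p\<close> is the single edge
  from \<open>x\<close> to \<open>y\<close>, which \<open>q\<close> could share. Every edge of
  \<open>p\<close> thus has an end off \<open>q\<close> and differs from all edges of
  \<open>q\<close>.\<close>

lemma trace_Int_trace:
  assumes p: "distinct p" "successively E p" "hd p = x" "last p = y" "v \<in> set p - {x, y}"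
    and q: "successively E q" "set p \<inter> set q = {x, y}"
  shows "trace p \<inter> trace q \<subseteq> {pos x, pos y}"
proof
  fix z assume "z \<in> trace p \<inter> trace q"
  then obtain a b where ab: "(a, b) \<in> set (zip p (tl p))" "z \<in> path_image (\<gamma> a b)"
    and zq: "z \<in> trace q" by (auto simp: trace_def)
  have E: "E a b" "a \<in> set p" "b \<in> set p" using zip_tl_edge[OF p(2) ab(1)] by auto
  have "a \<notin> set q \<or> b \<notin> set q"
  proof (rule ccontr)
    assume "\<not> ?thesis"
    then have axy: "a \<in> {x, y}" "b \<in> {x, y}" using E q(2) by blast+
    obtain i where i: "a = p ! i" "b = p ! Suc i" "Suc i < length p"
      using ab(1) by (auto simp: set_zip nth_tl)
    have "p \<noteq> []" using i by auto
    then have x: "x = p ! 0" and y: "y = p ! (length p - 1)"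
      using p(3,4) by (auto simp: hd_conv_nth last_conv_nth)
    have "i = 0 \<or> i = length p - 1" "Suc i = length p - 1"
      using axy i \<open>p \<noteq> []\<close> p(1) unfolding x y by (auto simp: nth_eq_iff_index_eq)
    then have "length p = 2" using i by auto
    then obtain c d where "p = [c, d]"
      by (metis (no_types, lifting) One_nat_def Suc_1 length_0_conv length_Suc_conv)
    then show False using p(3,4,5) by auto
  qed
  then have "z \<in> pos ` ({a, b} \<inter> set q)"
  proof
    assume a: "a \<notin> set q"
    show ?thesis using edge_Int_trace[OF E(1) a q(1)] zq ab(2) by auto
  next
    assume b: "b \<notin> set q"
    obtain c d where cd: "(c, d) \<in> set (zip q (tl q))" "z \<in> path_image (\<gamma> c d)"
      using zq by (auto simp: trace_def)
    have F: "E c d" "c \<in> set q" "d \<in> set q" using zip_tl_edge[OF q(1) cd(1)] by auto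
    then have "{a, b} \<noteq> {c, d}" using b by auto
    then show ?thesis using edges_cross[OF E(1) F(1)] cd ab F by blast
  qed
  moreover have "{a, b} \<inter> set q \<subseteq> {x, y}" using E q(2) by auto
  ultimately show "z \<in> {pos x, pos y}" by blast
qed

text \<open>Graph version of \<open>no_common_face\<close>: the arms \<open>L j\<close> are drawn as
  arcs, and walks from \<open>s0\<close> that avoid the theta graph stay in one face
  \<open>C\<close> until their last edge ends in the interior of an arm.\<close>

lemma no_theta_with_common_face:
  fixes L :: "nat \<Rightarrow> 'a list"
  defines "\<Theta> \<equiv> (\<Union>j<3. set (L j))"
  assumes L: "\<And>j. j < 3 \<Longrightarrow> distinct (L j) \<and> successively E (L j) \<and> hd (L j) = x \<and> last (L j) = y"
    and meets: "\<And>j k. j < 3 \<Longrightarrow> k < 3 \<Longrightarrow> j \<noteq> k \<Longrightarrow> set (L j) \<inter> set (L k) = {x, y}"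
    and s0: "s0 \<in> V" "s0 \<notin> \<Theta>"
    and reach: "\<And>j. j < 3 \<Longrightarrow> \<exists>s w. (\<lambda>u v. E u v \<and> v \<notin> \<Theta>)\<^sup>*\<^sup>* s0 s \<and> E s w \<and> w \<in> set (L j) - {x, y}"
  shows False
proof -
  define T where "T = (\<Union>j<3. trace (L j))"
  define C where "C = connected_component_set (- T) (pos s0)"
  have reach_C: "pos s \<in> C \<and> s \<in> V \<and> s \<notin> \<Theta>" if "(\<lambda>u v. E u v \<and> v \<notin> \<Theta>)\<^sup>*\<^sup>* s0 s" for s
    using that
  proof (induction rule: rtranclp_induct)
    case base
    have "pos s0 \<notin> T"
      using vertex_notin_trace[OF s0(1)] s0(2) L unfolding T_def \<Theta>_def by blast
    then show ?case using s0 by (auto simp: C_def connected_component_refl_eq)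
  next
    case (step u v)
    then have E: "E u v" and uv: "u \<notin> \<Theta>" "v \<notin> \<Theta>" "pos u \<in> C" by auto
    have "path_image (\<gamma> u v) \<inter> trace (L j) = {}" if "j < 3" for j
      using edge_Int_trace[OF E, of "L j"] uv L[OF that] that by (auto simp: \<Theta>_def)
    then have "path_image (\<gamma> u v) \<subseteq> - T" by (auto simp: T_def)
    moreover have "connected (path_image (\<gamma> u v))"
      using edge_arc[OF E] by (simp add: connected_path_image arc_imp_path)
    ultimately have "path_image (\<gamma> u v) \<subseteq> connected_component_set (- T) (pos u)"
      using ends_in_edge[OF E] by (simp add: connected_component_maximal)
    also have "\<dots> = C" using uv(3) unfolding C_def by (metis connected_component_eq)
    finally show ?case using ends_in_edge[OF E] uv edge_in[OF E] by blast
  qed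
  have hit: "\<exists>w. w \<in> set (L j) - {x, y} \<and> pos w \<in> closure C" if j: "j < 3" for j
  proof -
    obtain s w where sw: "(\<lambda>u v. E u v \<and> v \<notin> \<Theta>)\<^sup>*\<^sup>* s0 s" "E s w" "w \<in> set (L j) - {x, y}"
      using reach[OF j] by blast
    have s: "pos s \<in> C" "s \<notin> \<Theta>" using reach_C[OF sw(1)] by auto
    \<comment> \<open>The last edge without its end on the arm is connected and avoids
      \<open>T\<close>, so it stays in the face \<open>C\<close>, and the omitted end is a limit
      point of \<open>C\<close>.\<close>
    define D where "D = path_image (\<gamma> s w) - {pos w}"
    have arc: "arc (\<gamma> s w)" "pathstart (\<gamma> s w) = pos s" "pathfinish (\<gamma> s w) = pos w"
      using edge_arc[OF sw(2)] by auto
    have "path_image (\<gamma> s w) \<inter> trace (L k) \<subseteq> {pos w}" if "k < 3" for k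
      using edge_Int_trace[OF sw(2), of "L k"] s L[OF that] that by (auto simp: \<Theta>_def)
    then have DT: "D \<subseteq> - T" by (auto simp: D_def T_def)
    have D_img: "D = \<gamma> s w ` {0..<1}"
    proof -
      have "\<gamma> s w 1 = pos w" using arc(3) by (simp add: pathfinish_def)
      moreover have "\<gamma> s w t \<noteq> \<gamma> s w 1" if "0 \<le> t" "t < 1" for t
        using arc(1) that inj_onD[of "\<gamma> s w" "{0..1}" t 1] by (auto simp: arc_def)
      moreover have "{0..1::real} = insert 1 {0..<1}" by auto
      ultimately show ?thesis by (auto simp: D_def path_image_def)
    qed
    have cont: "continuous_on {0..1} (\<gamma> s w)" using arc(1) by (simp add: arc_def path_def)
    have "connected D"
      unfolding D_img by (intro connected_continuous_image continuous_on_subset[OF cont]) auto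
    moreover have "pos s \<in> D"
      unfolding D_img using arc(2) by (force simp: pathstart_def)
    ultimately have "D \<subseteq> connected_component_set (- T) (pos s)"
      using DT by (simp add: connected_component_maximal)
    also have "\<dots> = C" using s(1) unfolding C_def by (metis connected_component_eq)
    finally have DC: "D \<subseteq> C" .
    have "\<gamma> s w ` closure {0..<1} \<subseteq> closure D"
      unfolding D_img by (rule continuous_image_closure_subset[OF cont]) auto
    then have "\<gamma> s w 1 \<in> closure D" by force
    then have "pos w \<in> closure D" using arc(3) by (simp add: pathfinish_def)
    then show ?thesis using sw(3) closure_mono[OF DC] by blast
  qed
  have len: "2 \<le> length (L j)" if j: "j < 3" for j
  proof -
    obtain w where "w \<in> set (L j) - {x, y}" using hit[OF j] by blast
    then show ?thesis using L[OF j] by (cases "L j" rule: remdups_adj.cases) auto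
  qed
  have "\<exists>g. arc g \<and> pathstart g = pos x \<and> pathfinish g = pos y \<and> path_image g = trace (L j)" if "j < 3" for j
    using trace_arc[of "L j"] L[OF that] len[OF that] by auto
  then obtain g where g: "\<And>j. j < 3 \<Longrightarrow> arc (g j) \<and> pathstart (g j) = pos x
      \<and> pathfinish (g j) = pos y \<and> path_image (g j) = trace (L j)" by metis
  have inV: "set (L j) \<subseteq> V" if "j < 3" for j
  proof -
    have "set p \<subseteq> V" if "successively E p" "2 \<le> length p" for p
      using that
    proof (induction p rule: induct_list012)
      case (3 u v r)
      then have "u \<in> V" "v \<in> V" using edge_in[of u v] by auto
      then show ?case using 3 by (cases r) auto
    qed auto
    then show ?thesis using L[OF that] len[OF that] by auto
  qed
  have int: "path_image (g j) \<inter> path_image (g k) = {pos x, pos y}" if j: "j < 3" and "k < 3" "j \<noteq> k" for j k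
  proof
    obtain w where "w \<in> set (L j) - {x, y}" using hit[OF j] by blast
    then show "path_image (g j) \<inter> path_image (g k) \<subseteq> {pos x, pos y}"
      using trace_Int_trace[of "L j" x y w "L k"] L that meets g by auto
    show "{pos x, pos y} \<subseteq> path_image (g j) \<inter> path_image (g k)"
      using g that by (metis (no_types, lifting) IntI empty_subsetI insert_subset
          pathfinish_in_path_image pathstart_in_path_image)
  qed
  have interior: "\<exists>z. z \<in> closure C \<and> z \<in> path_image (g j) - {pos x, pos y}" if j: "j < 3" for j
  proof -
    obtain w where w: "w \<in> set (L j) - {x, y}" "pos w \<in> closure C" using hit[OF j] by blast
    have "x \<in> set (L j)" "y \<in> set (L j)"
      using L[OF j] len[OF j] by (metis hd_in_set last_in_set list.size(3) not_numeral_le_zero)+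
    then have "pos w \<notin> {pos x, pos y}" using w(1) inV[OF j] inj_pos by (auto dest: inj_onD)
    moreover have "pos w \<in> trace (L j)" using trace_arc[of "L j"] L[OF j] len[OF j] w by auto
    ultimately show ?thesis using w g[OF j] by blast
  qed
  interpret theta_curve "g 0" "g 1" "g 2" "pos x" "pos y"
    by unfold_locales (use g int in auto)
  have "connected C" unfolding C_def by simp
  moreover have "C \<subseteq> - T" unfolding C_def by (rule connected_component_subset)
  then have "C \<inter> (path_image (g 0) \<union> path_image (g 1) \<union> path_image (g 2)) = {}"
    using g[of 0] g[of 1] g[of 2] by (auto simp: T_def)
  ultimately show False
    using no_common_face interior[of 0] interior[of 1] interior[of 2] by fastforce
qed

text \<open>Tripods in \<open>S 0\<close> and \<open>S 1\<close>, linked by paths through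
  \<open>B 0\<close>, \<open>B 1\<close>, \<open>B 2\<close>, form a theta graph. The third set
  \<open>S 2\<close> is disjoint from it and reaches the interior of arm \<open>j\<close> through
  \<open>B j\<close>.\<close>

lemma no_K33_minor:
  fixes S B :: "nat \<Rightarrow> 'a set"
  assumes conn: "\<And>i. i < 3 \<Longrightarrow> connected_in E (S i)" "\<And>j. j < 3 \<Longrightarrow> connected_in E (B j)"
    and disj: "\<And>i k. i < 3 \<Longrightarrow> k < 3 \<Longrightarrow> i \<noteq> k \<Longrightarrow> S i \<inter> S k = {}"
      "\<And>i k. i < 3 \<Longrightarrow> k < 3 \<Longrightarrow> i \<noteq> k \<Longrightarrow> B i \<inter> B k = {}"
      "\<And>i j. i < 3 \<Longrightarrow> j < 3 \<Longrightarrow> S i \<inter> B j = {}"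
    and adj: "\<And>i j. i < 3 \<Longrightarrow> j < 3 \<Longrightarrow> \<exists>s\<in>S i. \<exists>t\<in>B j. E s t"
  shows False
proof -
  have "\<exists>s t. \<forall>i<3. \<forall>j<3. s i j \<in> S i \<and> t i j \<in> B j \<and> E (s i j) (t i j)"
    using adj by metis
  then obtain s t where st: "\<And>i j. i < 3 \<Longrightarrow> j < 3 \<Longrightarrow> s i j \<in> S i \<and> t i j \<in> B j \<and> E (s i j) (t i j)"
    by blast
  obtain x X where x: "x \<in> S 0"
    and X: "\<And>j. j < 3 \<Longrightarrow> X j \<noteq> [] \<and> hd (X j) = x \<and> last (X j) = s 0 j \<and> distinct (X j)
        \<and> successively E (X j) \<and> set (X j) \<subseteq> S 0"
    and XX: "\<And>j k. j < 3 \<Longrightarrow> k < 3 \<Longrightarrow> j \<noteq> k \<Longrightarrow> set (X j) \<inter> set (X k) = {x}"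
    using connected_in_tripod[OF conn(1)[of 0] sym, of "s 0"] st by auto
  obtain y Y where y: "y \<in> S 1"
    and Y: "\<And>j. j < 3 \<Longrightarrow> Y j \<noteq> [] \<and> hd (Y j) = y \<and> last (Y j) = s 1 j \<and> distinct (Y j)
        \<and> successively E (Y j) \<and> set (Y j) \<subseteq> S 1"
    and YY: "\<And>j k. j < 3 \<Longrightarrow> k < 3 \<Longrightarrow> j \<noteq> k \<Longrightarrow> set (Y j) \<inter> set (Y k) = {y}"
    using connected_in_tripod[OF conn(1)[of 1] sym, of "s 1"] st by auto
  have "\<exists>m. m \<noteq> [] \<and> hd m = t 0 j \<and> last m = t 1 j \<and> distinct m \<and> successively E m \<and> set m \<subseteq> B j"
    if "j < 3" for j
    using connected_in_obtain_path[OF conn(2)[OF that], of "t 0 j" "t 1 j"] st that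
    by (metis one_less_numeral_iff semiring_norm(77) zero_less_numeral)
  then obtain M where M: "\<And>j. j < 3 \<Longrightarrow> M j \<noteq> [] \<and> hd (M j) = t 0 j \<and> last (M j) = t 1 j
      \<and> distinct (M j) \<and> successively E (M j) \<and> set (M j) \<subseteq> B j" by metis
  define L where "L = (\<lambda>j. X j @ M j @ rev (Y j))"
  define \<Theta> where "\<Theta> = (\<Union>j<3. set (L j))"
  have symE: "successively (\<lambda>x y. E y x) l = successively E l" for l
    using sym by (auto elim: successively_mono)
  have S01: "S 0 \<inter> S 1 = {}" "S 2 \<inter> S 0 = {}" "S 2 \<inter> S 1 = {}" using disj(1) by auto
  have setL: "set (L j) = set (X j) \<union> set (M j) \<union> set (Y j)" for j by (auto simp: L_def)
  have L: "distinct (L j) \<and> successively E (L j) \<and> hd (L j) = x \<and> last (L j) = y" if j: "j < 3" for j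
  proof -
    have "S 0 \<inter> B j = {}" "S 1 \<inter> B j = {}" using disj(3) j by auto
    then have "distinct (L j)" using X[OF j] M[OF j] Y[OF j] S01 by (auto simp: L_def)
    moreover have "successively E (L j)"
      using X[OF j] M[OF j] Y[OF j] st[of 0 j] st[of 1 j] j
      by (auto simp: L_def successively_append_iff symE hd_append hd_rev intro: sym)
    ultimately show ?thesis
      using X[OF j] M[OF j] Y[OF j] by (auto simp: L_def last_rev)
  qed
  have LL: "set (L j) \<inter> set (L k) = {x, y}" if jk: "j < 3" "k < 3" "j \<noteq> k" for j k
  proof -
    have sub: "set (X i) \<subseteq> S 0" "set (M i) \<subseteq> B i" "set (Y i) \<subseteq> S 1" if "i < 3" for i
      using X[OF that] M[OF that] Y[OF that] by auto
    have SB: "S i \<inter> B l = {}" if "i < 3" "l < 3" for i l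
      using disj(3) that by auto
    have "set (X j) \<inter> set (M k) = {}" "set (M j) \<inter> set (X k) = {}"
      using sub(1,2)[OF jk(1)] sub(1,2)[OF jk(2)] SB[of 0 j] SB[of 0 k] jk by auto
    moreover have "set (Y j) \<inter> set (M k) = {}" "set (M j) \<inter> set (Y k) = {}"
      using sub(2,3)[OF jk(1)] sub(2,3)[OF jk(2)] SB[of 1 j] SB[of 1 k] jk by auto
    moreover have "set (M j) \<inter> set (M k) = {}"
      using sub(2)[OF jk(1)] sub(2)[OF jk(2)] disj(2)[OF jk] by auto
    moreover have "set (X j) \<inter> set (Y k) = {}" "set (Y j) \<inter> set (X k) = {}"
      using sub(1,3)[OF jk(1)] sub(1,3)[OF jk(2)] S01 by auto
    ultimately show ?thesis
      using XX[OF jk] YY[OF jk] unfolding setL by (auto simp: Int_Un_distrib Int_Un_distrib2)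
  qed
  have outside: "S 2 \<inter> \<Theta> = {}"
  proof -
    have "S 2 \<inter> set (L j) = {}" if "j < 3" for j
      using X[OF that] M[OF that] Y[OF that] S01 disj(3)[of 2 j] that unfolding setL by auto
    then show ?thesis by (auto simp: \<Theta>_def)
  qed
  have s0: "s 2 0 \<in> S 2" "s 2 0 \<in> V" using st[of 2 0] edge_in by auto
  have "\<exists>u w. (\<lambda>u v. E u v \<and> v \<notin> \<Theta>)\<^sup>*\<^sup>* (s 2 0) u \<and> E u w \<and> w \<in> set (L j) - {x, y}" if j: "j < 3" for j
  proof -
    \<comment> \<open>A walk restricted to \<open>S 2\<close> and \<open>B j\<close> runs from
      \<open>s 2 0\<close> to \<open>t 0 j\<close>, which is on the theta graph. Its first vertex
      there is not in \<open>S 2\<close>, hence in \<open>B j\<close>, and \<open>B j\<close> meets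
      the theta graph only in the interior of arm \<open>j\<close>.\<close>
    define Q where "Q = (\<lambda>u v. E u v \<and> v \<in> S 2 \<union> B j)"
    have s2: "s 2 j \<in> S 2" "t 2 j \<in> B j" "E (s 2 j) (t 2 j)" "t 0 j \<in> B j" using st[of 2 j] st[of 0 j] j by auto
    have "Q\<^sup>*\<^sup>* (s 2 0) (s 2 j)"
      using conn(1)[of 2] s0 s2 unfolding connected_in_def
      by (force simp: Q_def elim!: mono_rtranclp[rule_format, rotated])
    moreover have "Q (s 2 j) (t 2 j)" using s2 by (simp add: Q_def)
    moreover have "Q\<^sup>*\<^sup>* (t 2 j) (t 0 j)"
      using conn(2)[OF j] s2 unfolding connected_in_def
      by (force simp: Q_def elim!: mono_rtranclp[rule_format, rotated])
    ultimately have "Q\<^sup>*\<^sup>* (s 2 0) (t 0 j)" by (meson rtranclp.rtrancl_into_rtrancl rtranclp_trans)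
    moreover have "t 0 j \<in> \<Theta>"
      using M[OF j] j hd_in_set[of "M j"] by (force simp: \<Theta>_def setL)
    ultimately obtain u w where uw: "(\<lambda>x y. Q x y \<and> y \<notin> \<Theta>)\<^sup>*\<^sup>* (s 2 0) u" "Q u w" "w \<in> \<Theta>"
      using rtranclp_first_hit[of Q "s 2 0" "t 0 j" \<Theta>] s0 outside by blast
    have "w \<in> B j" using uw outside by (auto simp: Q_def)
    moreover have "k = j" if k: "k < 3" "w \<in> set (L k)" for k
    proof -
      have "w \<in> S 0 \<union> B k \<union> S 1"
        using X[OF k(1)] M[OF k(1)] Y[OF k(1)] k(2) unfolding setL by blast
      moreover have "w \<notin> S 0" "w \<notin> S 1"
        using \<open>w \<in> B j\<close> disj(3)[of 0 j] disj(3)[of 1 j] j by auto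
      ultimately show "k = j" using \<open>w \<in> B j\<close> disj(2)[OF k(1) j] by blast
    qed
    ultimately have "w \<in> set (L j) - {x, y}"
      using uw(3) x y disj(3)[of 0 j] disj(3)[of 1 j] j by (auto simp: \<Theta>_def)
    moreover have "(\<lambda>u v. E u v \<and> v \<notin> \<Theta>)\<^sup>*\<^sup>* (s 2 0) u"
      using uw(1) by (rule mono_rtranclp[rule_format, rotated]) (auto simp: Q_def)
    ultimately show ?thesis using uw(2) by (auto simp: Q_def)
  qed
  then show False
    using no_theta_with_common_face[of L x y "s 2 0"] L LL s0 outside unfolding \<Theta>_def by blast
qed

end

subsection \<open>Disjoint paths forming a subdivided \<open>K\<^sub>3\<^sub>,\<^sub>3\<close>\<close>

lemma connected_in_UN:
  assumes "\<And>i. i \<in> I \<Longrightarrow> connected_in E (S i)" "\<And>i. i \<in> I \<Longrightarrow> a \<in> S i"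
  shows "connected_in E (\<Union>i\<in>I. S i)"
  unfolding connected_in_def
proof (intro ballI)
  fix u v assume "u \<in> (\<Union>i\<in>I. S i)" "v \<in> (\<Union>i\<in>I. S i)"
  then obtain i k where ik: "i \<in> I" "u \<in> S i" "k \<in> I" "v \<in> S k" by blast
  let ?R = "\<lambda>x y. E x y \<and> x \<in> (\<Union>i\<in>I. S i) \<and> y \<in> (\<Union>i\<in>I. S i)"
  have mono: "?R\<^sup>*\<^sup>* x y" if "(\<lambda>x y. E x y \<and> x \<in> S l \<and> y \<in> S l)\<^sup>*\<^sup>* x y" "l \<in> I" for x y l
    using that(1) by (rule mono_rtranclp[rule_format, rotated]) (use that(2) in auto)
  have "?R\<^sup>*\<^sup>* u a" "?R\<^sup>*\<^sup>* a v"
    using assms ik mono unfolding connected_in_def by meson+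
  then show "?R\<^sup>*\<^sup>* u v" by (rule rtranclp_trans)
qed

lemma connected_in_reachable:
  assumes sym: "\<And>x y. E x y \<Longrightarrow> E y x"
  shows "connected_in E {v. (\<lambda>x y. E x y \<and> y \<in> D)\<^sup>*\<^sup>* a v}" (is "connected_in E ?S")
proof -
  let ?R = "\<lambda>x y. E x y \<and> x \<in> ?S \<and> y \<in> ?S"
  have from_a: "?R\<^sup>*\<^sup>* a v" if "v \<in> ?S" for v
  proof -
    from that have "(\<lambda>x y. E x y \<and> y \<in> D)\<^sup>*\<^sup>* a v" by simp
    then show ?thesis
    proof (induction rule: rtranclp_induct)
      case (step y z)
      then have "?R y z" by (auto intro: rtranclp.rtrancl_into_rtrancl)
      with step.IH show ?case by (rule rtranclp.rtrancl_into_rtrancl)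
    qed simp
  qed
  have "symp ?R\<^sup>*\<^sup>*" using sym by (intro symp_rtranclp) (auto simp: symp_def)
  then show ?thesis
    unfolding connected_in_def using from_a by (metis (no_types, lifting) rtranclp_trans sympD)
qed

lemma connected_in_graph_path:
  assumes "graph_path V E p" and sym: "\<And>x y. E x y \<Longrightarrow> E y x"
  shows "connected_in E (set p)"
proof -
  let ?R = "\<lambda>x y. E x y \<and> x \<in> set p \<and> y \<in> set p"
  have p: "p \<noteq> []" "\<And>i. Suc i < length p \<Longrightarrow> E (p ! i) (p ! Suc i)"
    using assms(1) by (auto simp: graph_path_def)
  have from_hd: "?R\<^sup>*\<^sup>* (p ! 0) (p ! i)" if "i < length p" for i
    using that
  proof (induction i)
    case (Suc i)
    then have "?R (p ! i) (p ! Suc i)" using p by auto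
    moreover have "?R\<^sup>*\<^sup>* (p ! 0) (p ! i)" using Suc by simp
    ultimately show ?case by (rule rtranclp.rtrancl_into_rtrancl[rotated])
  qed simp
  have "symp ?R\<^sup>*\<^sup>*" using sym by (intro symp_rtranclp) (auto simp: symp_def)
  then show ?thesis
    unfolding connected_in_def using from_hd
    by (metis (no_types, lifting) in_set_conv_nth rtranclp_trans sympD)
qed

text \<open>\<open>P i j\<close> and \<open>Q i j\<close> are the two halves of an edge subdivided
  at \<open>m i j\<close>. They may also meet elsewhere, so the unions \<open>A i\<close> and
  \<open>B j\<close> can overlap; trimming \<open>A i\<close> before it enters the sets
  \<open>B j\<close> yields the branch sets of a minor.\<close>

lemma (in plane_drawing) no_disjoint_subdivided_K33:
  fixes P Q :: "nat \<Rightarrow> nat \<Rightarrow> 'a list"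
  assumes paths: "\<And>i j. i < 3 \<Longrightarrow> j < 3 \<Longrightarrow> graph_path V E (P i j)"
      "\<And>i j. i < 3 \<Longrightarrow> j < 3 \<Longrightarrow> graph_path V E (Q i j)"
    and a: "\<And>i j. i < 3 \<Longrightarrow> j < 3 \<Longrightarrow> a i \<in> set (P i j)"
    and b: "\<And>i j. i < 3 \<Longrightarrow> j < 3 \<Longrightarrow> b j \<in> set (Q i j)"
    and m: "\<And>i j. i < 3 \<Longrightarrow> j < 3 \<Longrightarrow> m i j \<in> set (P i j) \<inter> set (Q i j)"
    and PP: "\<And>i j k l. i < 3 \<Longrightarrow> j < 3 \<Longrightarrow> k < 3 \<Longrightarrow> l < 3 \<Longrightarrow> i \<noteq> k \<Longrightarrow> set (P i j) \<inter> set (P k l) = {}"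
    and QQ: "\<And>i j k l. i < 3 \<Longrightarrow> j < 3 \<Longrightarrow> k < 3 \<Longrightarrow> l < 3 \<Longrightarrow> j \<noteq> l \<Longrightarrow> set (Q i j) \<inter> set (Q k l) = {}"
    and PQ: "\<And>i j k l. i < 3 \<Longrightarrow> j < 3 \<Longrightarrow> k < 3 \<Longrightarrow> l < 3 \<Longrightarrow> (i, j) \<noteq> (k, l) \<Longrightarrow>
      set (P i j) \<inter> set (Q k l) = {}"
  shows False
proof -
  define A where "A = (\<lambda>i. \<Union>j<3. set (P i j))"
  define B where "B = (\<lambda>j. \<Union>i<3. set (Q i j))"
  define D where "D = (\<lambda>i. A i - (\<Union>j<3. B j))"
  \<comment> \<open>\<open>S i\<close> is the part of \<open>A i\<close> reachable from \<open>a i\<close> before the first vertex of some \<open>B j\<close>.\<close>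
  define S where "S = (\<lambda>i. {v. (\<lambda>x y. E x y \<and> y \<in> D i)\<^sup>*\<^sup>* (a i) v})"
  have aD: "a i \<in> D i" if i: "i < 3" for i
  proof -
    have "a i \<notin> B j" if j: "j < 3" for j
    proof
      assume "a i \<in> B j"
      then obtain k where k: "k < 3" "a i \<in> set (Q k j)" by (auto simp: B_def)
      \<comment> \<open>With an index \<open>l\<close> other than \<open>j\<close>, the path
        \<open>P i l\<close> contains \<open>a i\<close> and is disjoint from every
        \<open>Q k j\<close>.\<close>
      obtain l :: nat where l: "l < 3" "l \<noteq> j" using that[of 0] that[of 1] by (cases "j = 0") auto
      show False using PQ[OF i l(1) k(1) j] a[OF i l(1)] k(2) l(2) by auto
    qed
    moreover have "a i \<in> A i" using a[OF i, of 0] by (auto simp: A_def)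
    ultimately show ?thesis by (auto simp: D_def)
  qed
  have SD: "S i \<subseteq> D i" if "i < 3" for i
  proof
    fix v assume "v \<in> S i"
    then have "(\<lambda>x y. E x y \<and> y \<in> D i)\<^sup>*\<^sup>* (a i) v" by (simp add: S_def)
    then show "v \<in> D i" by cases (use aD[OF that] in auto)
  qed
  show False
  proof (rule no_K33_minor[of S B])
    fix i :: nat assume i: "i < 3"
    show "connected_in E (S i)" unfolding S_def by (rule connected_in_reachable) (rule sym)
    show "connected_in E (B i)"
      unfolding B_def
      by (rule connected_in_UN[where a = "b i"])
        (use i b connected_in_graph_path[OF paths(2) sym] in auto)
    fix k :: nat assume k: "k < 3"
    show "S i \<inter> B k = {}" using SD[OF i] k by (auto simp: D_def)
    show "\<exists>s\<in>S i. \<exists>t\<in>B k. E s t"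
    proof -
      \<comment> \<open>Walk along \<open>P i k\<close> from \<open>a i\<close> to
        \<open>m i k\<close>. The first vertex \<open>w\<close> outside \<open>S i\<close> has to
        lie on some \<open>Q n l\<close>, and by disjointness this can only be \<open>Q i k\<close>,
        so \<open>w\<close> is in \<open>B k\<close>.\<close>
      let ?Q = "\<lambda>x y. E x y \<and> x \<in> set (P i k) \<and> y \<in> set (P i k)"
      have "?Q\<^sup>*\<^sup>* (a i) (m i k)"
        using connected_in_graph_path[OF paths(1)[OF i k] sym] a[OF i k] m[OF i k]
        unfolding connected_in_def by blast
      moreover have "m i k \<in> B k" using m[OF i k] i by (auto simp: B_def)
      then have "m i k \<notin> S i" using SD[OF i] k by (auto simp: D_def)
      moreover have aS: "a i \<in> S i" by (simp add: S_def)
      ultimately obtain s w where sw: "(\<lambda>x y. ?Q x y \<and> y \<notin> - S i)\<^sup>*\<^sup>* (a i) s" "?Q s w" "w \<in> - S i"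
        using rtranclp_first_hit[of ?Q "a i" "m i k" "- S i"] by blast
      have sS: "s \<in> S i" using sw(1) by cases (use aS in auto)
      have "w \<notin> D i"
        using sS sw by (auto simp: S_def intro: rtranclp.rtrancl_into_rtrancl)
      moreover have "w \<in> A i" using sw(2) k by (auto simp: A_def)
      ultimately obtain l n where ln: "l < 3" "n < 3" "w \<in> set (Q n l)"
        by (auto simp: D_def B_def)
      then have "(i, k) = (n, l)" using PQ[OF i k ln(2,1)] sw(2) by auto
      then have "w \<in> B k" using ln by (auto simp: B_def)
      then show ?thesis using sS sw(2) by blast
    qed
    assume ik: "i \<noteq> k"
    have "A i \<inter> A k = {}" using PP i k ik unfolding A_def by blast
    then show "S i \<inter> S k = {}" using SD[OF i] SD[OF k] by (auto simp: D_def)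
    show "B i \<inter> B k = {}" using QQ i k ik unfolding B_def by blast
  qed
qed

subsection \<open>A union bound for independent choices\<close>

text \<open>The weights describe independent random coordinates, and a function of two of them has
  the expectation given by these two alone, since the other factors sum to 1. It is shown for the
  indicator of a single pair of values and extended by linearity.\<close>

lemma sum_PiE_pair_marginal:
  fixes w :: "'i \<Rightarrow> 'b \<Rightarrow> real"
  assumes fin: "finite I" "\<And>i. i \<in> I \<Longrightarrow> finite (A i)"
    and one: "\<And>i. i \<in> I \<Longrightarrow> (\<Sum>x\<in>A i. w i x) = 1"
    and ij: "i \<in> I" "j \<in> I" "i \<noteq> j"
  shows "(\<Sum>\<pi>\<in>PiE I A. (\<Prod>k\<in>I. w k (\<pi> k)) * F (\<pi> i) (\<pi> j))
    = (\<Sum>x\<in>A i. \<Sum>y\<in>A j. w i x * w j y * F x y)"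
proof -
  have point: "(\<Sum>\<pi>\<in>PiE I A. (\<Prod>k\<in>I. w k (\<pi> k)) * of_bool (\<pi> i = x \<and> \<pi> j = y)) = w i x * w j y"
    if xy: "x \<in> A i" "y \<in> A j" for x y
  proof -
    \<comment> \<open>The indicator is absorbed into the factors at \<open>i\<close> and
      \<open>j\<close>, so that the sum over all choices factorises.\<close>
    define h where "h = (\<lambda>k z. w k z * of_bool ((k = i \<longrightarrow> z = x) \<and> (k = j \<longrightarrow> z = y)))"
    have "(\<Prod>k\<in>I. w k (\<pi> k)) * of_bool (\<pi> i = x \<and> \<pi> j = y) = (\<Prod>k\<in>I. h k (\<pi> k))" for \<pi>
    proof (cases "\<pi> i = x \<and> \<pi> j = y")
      case True
      then show ?thesis by (auto simp: h_def intro!: prod.cong)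
    next
      case False
      then have "\<exists>k\<in>I. h k (\<pi> k) = 0" using ij by (auto simp: h_def)
      then have "(\<Prod>k\<in>I. h k (\<pi> k)) = 0" using fin(1) by (simp add: prod_zero)
      then show ?thesis using False by simp
    qed
    then have "(\<Sum>\<pi>\<in>PiE I A. (\<Prod>k\<in>I. w k (\<pi> k)) * of_bool (\<pi> i = x \<and> \<pi> j = y))
        = (\<Prod>k\<in>I. \<Sum>z\<in>A k. h k z)"
      using prod_sum_PiE[where f = h, OF fin] by simp
    also have "\<dots> = (\<Sum>z\<in>A i. h i z) * ((\<Sum>z\<in>A j. h j z) * (\<Prod>k\<in>I - {i} - {j}. \<Sum>z\<in>A k. h k z))"
      using fin(1) ij by (simp add: prod.remove[of I i] prod.remove[of "I - {i}" j])
    also have "(\<Prod>k\<in>I - {i} - {j}. \<Sum>z\<in>A k. h k z) = 1"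
      using one by (intro prod.neutral) (auto simp: h_def)
    also have "(\<Sum>z\<in>A i. h i z) = w i x"
      using xy fin ij by (simp add: h_def of_bool_def if_distrib[of "(*) _"] cong: if_cong)
    also have "(\<Sum>z\<in>A j. h j z) = w j y"
      using xy fin ij by (simp add: h_def of_bool_def if_distrib[of "(*) _"] cong: if_cong)
    finally show ?thesis by simp
  qed
  have "(\<Sum>\<pi>\<in>PiE I A. (\<Prod>k\<in>I. w k (\<pi> k)) * F (\<pi> i) (\<pi> j))
     = (\<Sum>\<pi>\<in>PiE I A. \<Sum>x\<in>A i. \<Sum>y\<in>A j. F x y * ((\<Prod>k\<in>I. w k (\<pi> k)) * of_bool (\<pi> i = x \<and> \<pi> j = y)))"
  proof (rule sum.cong[OF refl])
    fix \<pi> assume "\<pi> \<in> PiE I A"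
    then have mem: "\<pi> i \<in> A i" "\<pi> j \<in> A j" using ij by (auto simp: PiE_def)
    have "(\<Sum>x\<in>A i. \<Sum>y\<in>A j. F x y * ((\<Prod>k\<in>I. w k (\<pi> k)) * of_bool (\<pi> i = x \<and> \<pi> j = y)))
        = (\<Sum>x\<in>A i. \<Sum>y\<in>A j. if x = \<pi> i \<and> y = \<pi> j then F x y * (\<Prod>k\<in>I. w k (\<pi> k)) else 0)"
      by (rule sum.cong[OF refl], rule sum.cong[OF refl]) auto
    also have "\<dots> = (\<Sum>x\<in>A i. if x = \<pi> i then \<Sum>y\<in>A j. if y = \<pi> j then F x y * (\<Prod>k\<in>I. w k (\<pi> k)) else 0 else 0)"
      by (rule sum.cong[OF refl]) simp
    also have "\<dots> = (\<Prod>k\<in>I. w k (\<pi> k)) * F (\<pi> i) (\<pi> j)"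
      using mem fin ij by simp
    finally show "(\<Prod>k\<in>I. w k (\<pi> k)) * F (\<pi> i) (\<pi> j) = (\<Sum>x\<in>A i. \<Sum>y\<in>A j.
        F x y * ((\<Prod>k\<in>I. w k (\<pi> k)) * of_bool (\<pi> i = x \<and> \<pi> j = y)))" by simp
  qed
  also have "\<dots> = (\<Sum>x\<in>A i. \<Sum>y\<in>A j. \<Sum>\<pi>\<in>PiE I A. F x y * ((\<Prod>k\<in>I. w k (\<pi> k)) * of_bool (\<pi> i = x \<and> \<pi> j = y)))"
    by (subst sum.swap) (intro sum.cong refl, rule sum.swap)
  also have "\<dots> = (\<Sum>x\<in>A i. \<Sum>y\<in>A j. F x y * (w i x * w j y))"
    using point by (intro sum.cong refl) (simp flip: sum_distrib_left)
  finally show ?thesis by (simp add: mult_ac)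
qed

text \<open>Every choice of positive weight contains a bad pair, so the expected number of bad pairs
  is at least 1. The diagonal is excluded because the marginal formula concerns two different
  coordinates.\<close>

lemma weighted_union_bound:
  fixes w :: "'i \<Rightarrow> 'b \<Rightarrow> real"
  assumes fin: "finite I" "\<And>i. i \<in> I \<Longrightarrow> finite (A i)"
    and one: "\<And>i. i \<in> I \<Longrightarrow> (\<Sum>x\<in>A i. w i x) = 1"
    and nonneg: "\<And>i x. 0 \<le> w i x"
    and D: "D \<subseteq> I \<times> I" "\<And>i. (i, i) \<notin> D"
    and bad: "\<And>\<pi>. \<pi> \<in> PiE I A \<Longrightarrow> (\<And>i. i \<in> I \<Longrightarrow> w i (\<pi> i) \<noteq> 0) \<Longrightarrow> \<exists>(i, j)\<in>D. R (\<pi> i) (\<pi> j)"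
  shows "1 \<le> (\<Sum>(i, j)\<in>D. \<Sum>x\<in>A i. \<Sum>y\<in>A j. w i x * w j y * of_bool (R x y))"
proof -
  have finD: "finite D" using D(1) fin(1) by (meson finite_SigmaI finite_subset)
  have "1 = (\<Prod>k\<in>I. \<Sum>x\<in>A k. w k x)" using one by simp
  also have "\<dots> = (\<Sum>\<pi>\<in>PiE I A. \<Prod>k\<in>I. w k (\<pi> k))" by (rule prod_sum_PiE[OF fin])
  also have "\<dots> \<le> (\<Sum>\<pi>\<in>PiE I A. \<Sum>(i, j)\<in>D. (\<Prod>k\<in>I. w k (\<pi> k)) * of_bool (R (\<pi> i) (\<pi> j)))"
  proof (rule sum_mono)
    fix \<pi> assume \<pi>: "\<pi> \<in> PiE I A"
    let ?W = "\<Prod>k\<in>I. w k (\<pi> k)"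
    have W: "0 \<le> ?W" using nonneg by (simp add: prod_nonneg)
    show "?W \<le> (\<Sum>(i, j)\<in>D. ?W * of_bool (R (\<pi> i) (\<pi> j)))"
    proof (cases "?W = 0")
      case False
      then have "\<And>i. i \<in> I \<Longrightarrow> w i (\<pi> i) \<noteq> 0" using fin(1) by auto
      then obtain i j where ij: "(i, j) \<in> D" "R (\<pi> i) (\<pi> j)" using bad[OF \<pi>] by blast
      then have "?W = (case (i, j) of (i, j) \<Rightarrow> ?W * of_bool (R (\<pi> i) (\<pi> j)))" by simp
      also have "\<dots> \<le> (\<Sum>(i, j)\<in>D. ?W * of_bool (R (\<pi> i) (\<pi> j)))"
        by (rule member_le_sum[OF ij(1)]) (use W finD in auto)
      finally show ?thesis .
    qed (use W in \<open>auto intro!: sum_nonneg\<close>)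
  qed
  also have "\<dots> = (\<Sum>(i, j)\<in>D. \<Sum>\<pi>\<in>PiE I A. (\<Prod>k\<in>I. w k (\<pi> k)) * of_bool (R (\<pi> i) (\<pi> j)))"
    by (subst sum.swap) (simp add: case_prod_beta)
  also have "\<dots> = (\<Sum>(i, j)\<in>D. \<Sum>x\<in>A i. \<Sum>y\<in>A j. w i x * w j y * of_bool (R x y))"
  proof (rule sum.cong[OF refl], clarify)
    fix i j assume "(i, j) \<in> D"
    then have "i \<in> I" "j \<in> I" "i \<noteq> j" using D by auto
    from sum_PiE_pair_marginal[where w = w and F = "\<lambda>x y. of_bool (R x y)", OF fin one this]
    show "(\<Sum>\<pi>\<in>PiE I A. (\<Prod>k\<in>I. w k (\<pi> k)) * of_bool (R (\<pi> i) (\<pi> j)))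
        = (\<Sum>x\<in>A i. \<Sum>y\<in>A j. w i x * w j y * of_bool (R x y))" by simp
  qed
  finally show ?thesis .
qed

subsection \<open>Routings\<close>

text \<open>
  The subdivided \<open>K\<^sub>3\<^sub>,\<^sub>3\<close> has branch vertices \<open>0,1,2\<close> and \<open>3,4,5\<close>, and \<open>6 + 3i + j\<close> subdivides the
  edge from \<open>i\<close> to \<open>3 + j\<close>. The edge \<open>(c, i, j)\<close> joins that vertex to \<open>i\<close> if \<open>c\<close> holds and
  to \<open>3 + j\<close> otherwise.
\<close>

definition K33_edges :: "(bool \<times> nat \<times> nat) set" where
  "K33_edges = UNIV \<times> {..<3} \<times> {..<3}"

definition branch_end :: "bool \<times> nat \<times> nat \<Rightarrow> nat" where
  "branch_end = (\<lambda>(c, i, j). if c then i else 3 + j)"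

definition subdivision_end :: "bool \<times> nat \<times> nat \<Rightarrow> nat" where
  "subdivision_end = (\<lambda>(c, i, j). 6 + 3 * i + j)"

text \<open>Pairs are ordered. Comparing like ends suffices, as branch ends are below 6 and
  subdivision ends are at least 6: the four ends are then pairwise distinct.\<close>

definition independent_edges :: "((bool \<times> nat \<times> nat) \<times> (bool \<times> nat \<times> nat)) set" where
  "independent_edges = {(e, e') \<in> K33_edges \<times> K33_edges.
     branch_end e \<noteq> branch_end e' \<and> subdivision_end e \<noteq> subdivision_end e'}"

lemma K33_edges_ends:
  assumes "e \<in> K33_edges"
  shows "branch_end e < 6" "6 \<le> subdivision_end e" "subdivision_end e < 15"
  using assms by (auto simp: K33_edges_def branch_end_def subdivision_end_def)

lemma finite_K33_edges: "finite K33_edges"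
  by (simp add: K33_edges_def)

text \<open>The bound 324 is the number \<open>18 * 18\<close> of all ordered pairs of
  edges.\<close>

lemma card_independent_edges: "finite independent_edges" "card independent_edges \<le> 324"
proof -
  have sub: "independent_edges \<subseteq> K33_edges \<times> K33_edges" by (auto simp: independent_edges_def)
  then show "finite independent_edges" using finite_K33_edges by (meson finite_SigmaI finite_subset)
  have "card (K33_edges \<times> K33_edges) = 324"
    by (simp add: K33_edges_def card_cartesian_product)
  then show "card independent_edges \<le> 324"
    using card_mono[OF _ sub] finite_K33_edges by simp
qed

section \<open>Counting placements with prescribed images\<close>

lemma card_funcset_prescribed_le:
  assumes "finite I" "finite V" "K \<subseteq> I"
  shows "card {f \<in> I \<rightarrow>\<^sub>E V. \<forall>k\<in>K. f k = g k} \<le> card V ^ (card I - card K)"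
proof -
  let ?S = "{f \<in> I \<rightarrow>\<^sub>E V. \<forall>k\<in>K. f k = g k}"
  have "inj_on (\<lambda>f. restrict f (I - K)) ?S"
  proof (rule inj_onI)
    fix f f' assume f: "f \<in> ?S" "f' \<in> ?S" and eq: "restrict f (I - K) = restrict f' (I - K)"
    show "f = f'"
    proof
      fix k
      show "f k = f' k"
        using f fun_cong[OF eq, of k] by (cases "k \<in> K"; cases "k \<in> I") (auto simp: PiE_def extensional_def)
    qed
  qed
  moreover have "(\<lambda>f. restrict f (I - K)) ` ?S \<subseteq> (I - K) \<rightarrow>\<^sub>E V" by auto
  moreover have "finite ((I - K) \<rightarrow>\<^sub>E V)" using assms by (intro finite_PiE) auto
  ultimately have "card ?S \<le> card ((I - K) \<rightarrow>\<^sub>E V)" by (rule card_inj_on_le)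
  also have "\<dots> = card V ^ (card I - card K)"
    using assms by (simp add: card_funcsetE card_Diff_subset finite_subset)
  finally show ?thesis .
qed

text \<open>The factor 4 counts the two orientations of each unordered pair, encoded by the two
  truth values in \<open>g\<close>; each orientation prescribes \<open>f\<close> at four distinct
  indices.\<close>

lemma card_funcset_two_edges_le:
  assumes "finite I" "finite V" and K: "{s, t, s', t'} \<subseteq> I" "card {s, t, s', t'} = 4"
  shows "card {f \<in> I \<rightarrow>\<^sub>E V. {h, l} = {f s, f t} \<and> {h', l'} = {f s', f t'}} \<le> 4 * card V ^ (card I - 4)"
proof -
  let ?K = "{s, t, s', t'}"
  define g where "g = (\<lambda>(c, d) k. if k = s then (if c then h else l) else if k = t then (if c then l else h)
    else if k = s' then (if d then h' else l') else (if d then l' else h'))"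
  define G where "G = (\<lambda>x. {f \<in> I \<rightarrow>\<^sub>E V. \<forall>k\<in>?K. f k = g x k})"
  have ne: "s \<noteq> t" "s \<noteq> s'" "s \<noteq> t'" "t \<noteq> s'" "t \<noteq> t'" "s' \<noteq> t'"
    using K(2) by (auto simp: card_insert_if split: if_splits)
  have fin: "finite (I \<rightarrow>\<^sub>E V)" using assms by (intro finite_PiE) auto
  have "{f \<in> I \<rightarrow>\<^sub>E V. {h, l} = {f s, f t} \<and> {h', l'} = {f s', f t'}} \<subseteq> (\<Union>x\<in>UNIV. G x)"
  proof
    fix f assume f: "f \<in> {f \<in> I \<rightarrow>\<^sub>E V. {h, l} = {f s, f t} \<and> {h', l'} = {f s', f t'}}"
    then have 1: "f s = h \<and> f t = l \<or> f s = l \<and> f t = h" and 2: "f s' = h' \<and> f t' = l' \<or> f s' = l' \<and> f t' = h'"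
      by (auto simp: doubleton_eq_iff)
    have "f \<in> G (f s = h \<and> f t = l, f s' = h' \<and> f t' = l')"
      using f 1 2 ne by (auto simp: G_def g_def)
    then show "f \<in> (\<Union>x\<in>UNIV. G x)" by blast
  qed
  then have "card {f \<in> I \<rightarrow>\<^sub>E V. {h, l} = {f s, f t} \<and> {h', l'} = {f s', f t'}} \<le> card (\<Union>x\<in>UNIV. G x)"
    using fin by (intro card_mono) (auto simp: G_def)
  also have "\<dots> \<le> (\<Sum>x\<in>UNIV. card (G x))" by (rule card_UN_le) simp
  also have "\<dots> \<le> (\<Sum>x\<in>(UNIV :: (bool \<times> bool) set). card V ^ (card I - 4))"
    using card_funcset_prescribed_le[OF assms(1,2) K(1)] K(2) by (intro sum_mono) (simp add: G_def)
  also have "\<dots> = 4 * card V ^ (card I - 4)" by (simp add: card_UNIV_bool flip: UNIV_Times_UNIV)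
  finally show ?thesis .
qed

lemma finite_paths_of: "finite V \<Longrightarrow> finite (paths_of V E)"
  by (rule finite_subset[OF _ finite_subset_distinct[of V]]) (auto simp: paths_of_def graph_path_def)

section \<open>Flow estimates for routings\<close>

locale routed_graph =
  fixes V :: "'a set" and E :: "'a \<Rightarrow> 'a \<Rightarrow> bool" and r :: "'a list \<Rightarrow> real"
  assumes fin: "finite V" and routing: "routing V E r"
begin

text \<open>Comparing sets of ends matches the routing condition, where paths in both directions
  contribute to the same unit.\<close>

definition joining :: "'a \<Rightarrow> 'a \<Rightarrow> 'a list set" where
  "joining u v = {p \<in> paths_of V E. {hd p, last p} = {u, v}}"

lemma nonneg: "0 \<le> r p"
  using routing by (simp add: routing_def)

lemma sum_joining:
  assumes "u \<in> V" "v \<in> V" "u \<noteq> v"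
  shows "(\<Sum>p\<in>joining u v. r p) = 1"
  using routing assms by (auto simp: routing_def joining_def doubleton_eq_iff)

lemma joining_ends:
  assumes "p \<in> joining u v"
  shows "u \<in> set p" "v \<in> set p" "graph_path V E p"
proof -
  show gp: "graph_path V E p" using assms by (simp add: joining_def paths_of_def)
  then have "p \<noteq> []" by (auto simp: graph_path_def)
  then have "hd p \<in> set p" "last p \<in> set p" by auto
  then show "u \<in> set p" "v \<in> set p" using assms by (auto simp: joining_def doubleton_eq_iff)
qed

lemma vertex_flow_le_max: "w \<in> V \<Longrightarrow> vertex_flow V E r w \<le> max_vertex_flow V E r"
  unfolding max_vertex_flow_def using fin by (intro Max_ge) auto

lemma vertex_flow_nonneg: "0 \<le> vertex_flow V E r w"
  unfolding vertex_flow_def using nonneg by (simp add: sum_nonneg)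

text \<open>Flow also counts at its endpoints, so the unit between \<open>u\<close> and
  \<open>v\<close> passes through \<open>u\<close>. This settles the lower bound for few
  vertices.\<close>

lemma max_vertex_flow_ge_1:
  assumes "2 \<le> card V"
  shows "1 \<le> max_vertex_flow V E r"
proof -
  obtain u v where uv: "u \<in> V" "v \<in> V" "u \<noteq> v"
    using assms fin by (metis One_nat_def card_le_Suc0_iff_eq not_less_eq_eq numeral_2_eq_2)
  have "1 = (\<Sum>p\<in>joining u v. r p)" using sum_joining[OF uv] by simp
  also have "\<dots> \<le> vertex_flow V E r u"
    unfolding vertex_flow_def
  proof (rule sum_mono2)
    show "finite {p \<in> paths_of V E. u \<in> set p}" using finite_paths_of[OF fin] by auto
    show "joining u v \<subseteq> {p \<in> paths_of V E. u \<in> set p}"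
      using joining_ends(1) by (auto simp: joining_def)
  qed (rule nonneg)
  also have "\<dots> \<le> max_vertex_flow V E r" by (rule vertex_flow_le_max[OF uv(1)])
  finally show ?thesis .
qed

text \<open>Grouping the paths by their end pairs gives one unit for each pair of vertices.\<close>

lemma sum_paths: "(\<Sum>p\<in>paths_of V E. r p) = real (card V choose 2)"
proof -
  let ?P = "{e. e \<subseteq> V \<and> card e = 2}"
  have finP: "finite ?P" using fin by auto
  have ends: "{hd p, last p} \<in> ?P" if "p \<in> paths_of V E" for p
  proof -
    have p: "distinct p" "2 \<le> length p" "set p \<subseteq> V" using that by (auto simp: paths_of_def graph_path_def)
    then have "p \<noteq> []" by auto
    then have "hd p \<noteq> last p"
      using p by (simp add: hd_conv_nth last_conv_nth nth_eq_iff_index_eq)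
    then show ?thesis using p \<open>p \<noteq> []\<close> by auto
  qed
  have "(\<Sum>p\<in>paths_of V E. r p) = (\<Sum>e\<in>?P. \<Sum>p\<in>{p \<in> paths_of V E. {hd p, last p} = e}. r p)"
    using finite_paths_of[OF fin] finP ends by (intro sum.group[symmetric]) auto
  also have "\<dots> = (\<Sum>e\<in>?P. 1)"
  proof (rule sum.cong[OF refl])
    fix e assume "e \<in> ?P"
    then obtain u v where uv: "e = {u, v}" "u \<noteq> v" "u \<in> V" "v \<in> V" by (auto simp: card_2_iff)
    then show "(\<Sum>p\<in>{p \<in> paths_of V E. {hd p, last p} = e}. r p) = 1"
      using sum_joining by (simp add: joining_def)
  qed
  finally show ?thesis using n_subsets[OF fin, of 2] by simp
qed

lemma max_vertex_flow_le:
  assumes "V \<noteq> {}"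
  shows "max_vertex_flow V E r \<le> real (card V) * (real (card V) - 1) / 2"
proof -
  have "vertex_flow V E r w \<le> (\<Sum>p\<in>paths_of V E. r p)" for w
    unfolding vertex_flow_def using finite_paths_of[OF fin] nonneg by (intro sum_mono2) auto
  moreover have "real (card V choose 2) = real (card V) * (real (card V) - 1) / 2"
    by (cases "card V") (simp_all add: choose_two real_of_nat_div algebra_simps)
  ultimately show ?thesis
    unfolding max_vertex_flow_def using fin assms sum_paths by (subst Max_le_iff) auto
qed

text \<open>Expanding the square of the flow at \<open>w\<close> gives the weight of all pairs of
  paths that both contain \<open>w\<close>; a pair that meets is counted for at least one
  \<open>w\<close>.\<close>

lemma sum_crossing_le_sum_flow_squared:
  "(\<Sum>p\<in>paths_of V E. \<Sum>q\<in>paths_of V E. r p * r q * of_bool (set p \<inter> set q \<noteq> {}))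
    \<le> (\<Sum>w\<in>V. (vertex_flow V E r w)\<^sup>2)"
proof -
  let ?P = "paths_of V E"
  have finP: "finite ?P" by (rule finite_paths_of[OF fin])
  have flow: "vertex_flow V E r w = (\<Sum>p\<in>?P. r p * of_bool (w \<in> set p))" for w
    unfolding vertex_flow_def using finP by (simp add: sum.inter_filter of_bool_def if_distrib cong: if_cong)
  have "r p * r q * of_bool (set p \<inter> set q \<noteq> {})
      \<le> (\<Sum>w\<in>V. (r p * of_bool (w \<in> set p)) * (r q * of_bool (w \<in> set q)))" if "p \<in> ?P" for p q
  proof (cases "set p \<inter> set q = {}")
    case True
    then show ?thesis using nonneg by (simp add: sum_nonneg)
  next
    case False
    then obtain w where w: "w \<in> set p" "w \<in> set q" by blast
    then have "w \<in> V" using that by (auto simp: paths_of_def graph_path_def)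
    have "r p * r q * of_bool (set p \<inter> set q \<noteq> {}) = (r p * of_bool (w \<in> set p)) * (r q * of_bool (w \<in> set q))"
      using w False by simp
    also have "\<dots> \<le> (\<Sum>w\<in>V. (r p * of_bool (w \<in> set p)) * (r q * of_bool (w \<in> set q)))"
      by (rule member_le_sum[OF \<open>w \<in> V\<close>]) (use nonneg fin in auto)
    finally show ?thesis .
  qed
  then have "(\<Sum>p\<in>?P. \<Sum>q\<in>?P. r p * r q * of_bool (set p \<inter> set q \<noteq> {}))
     \<le> (\<Sum>p\<in>?P. \<Sum>q\<in>?P. \<Sum>w\<in>V. (r p * of_bool (w \<in> set p)) * (r q * of_bool (w \<in> set q)))"
    by (intro sum_mono)
  also have "\<dots> = (\<Sum>p\<in>?P. \<Sum>w\<in>V. \<Sum>q\<in>?P. (r p * of_bool (w \<in> set p)) * (r q * of_bool (w \<in> set q)))"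
    by (rule sum.cong[OF refl], rule sum.swap)
  also have "\<dots> = (\<Sum>w\<in>V. \<Sum>p\<in>?P. \<Sum>q\<in>?P. (r p * of_bool (w \<in> set p)) * (r q * of_bool (w \<in> set q)))"
    by (rule sum.swap)
  also have "\<dots> = (\<Sum>w\<in>V. (vertex_flow V E r w)\<^sup>2)"
    by (simp only: flow power2_eq_square sum_product)
  finally show ?thesis .
qed

end

section \<open>Combination of the geometric and the counting arguments\<close>

locale routed_plane_graph = plane_drawing V E pos \<gamma> + routed_graph V E r
  for V :: "'a set" and E pos \<gamma> r
begin

text \<open>For a fixed placement \<open>f\<close>, each edge independently receives a path with
  probabilities given by \<open>r\<close>. Planarity forces two independent edges to receive meeting
  paths, so the union bound applies.\<close>

lemma crossing_in_random_K33:
  assumes f: "f \<in> {..<15} \<rightarrow> V" "inj_on f {..<15}"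
  shows "1 \<le> (\<Sum>(e, e')\<in>independent_edges.
     \<Sum>p\<in>joining (f (branch_end e)) (f (subdivision_end e)).
     \<Sum>q\<in>joining (f (branch_end e')) (f (subdivision_end e')).
       r p * r q * of_bool (set p \<inter> set q \<noteq> {}))"
proof (rule weighted_union_bound[where I = K33_edges])
  show "finite K33_edges" by (rule finite_K33_edges)
  show "finite (joining (f (branch_end e)) (f (subdivision_end e)))" for e
    using finite_paths_of[OF fin] by (simp add: joining_def)
  show "0 \<le> r p" for p by (rule nonneg)
  show "independent_edges \<subseteq> K33_edges \<times> K33_edges" "\<And>e. (e, e) \<notin> independent_edges"
    by (auto simp: independent_edges_def)
  fix e assume "e \<in> K33_edges"
  note e = K33_edges_ends[OF this]
  have "f (branch_end e) \<noteq> f (subdivision_end e)" "f (branch_end e) \<in> V" "f (subdivision_end e) \<in> V"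
    using e f by (auto dest!: inj_onD)
  then show "(\<Sum>p\<in>joining (f (branch_end e)) (f (subdivision_end e)). r p) = 1"
    by (intro sum_joining) auto
next
  fix \<pi> assume \<pi>: "\<pi> \<in> (\<Pi>\<^sub>E e\<in>K33_edges. joining (f (branch_end e)) (f (subdivision_end e)))"
  show "\<exists>(e, e')\<in>independent_edges. set (\<pi> e) \<inter> set (\<pi> e') \<noteq> {}"
  proof (rule ccontr)
    assume "\<not> ?thesis"
    then have disj: "set (\<pi> e) \<inter> set (\<pi> e') = {}" if "(e, e') \<in> independent_edges" for e e'
      using that by blast
    have E: "(c, i, j) \<in> K33_edges" if "i < 3" "j < 3" for c i j
      using that by (simp add: K33_edges_def)
    have mem: "\<pi> (c, i, j) \<in> joining (f (branch_end (c, i, j))) (f (subdivision_end (c, i, j)))"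
      if "i < 3" "j < 3" for c i j
      using PiE_mem[OF \<pi> E[OF that]] .
    note ends = joining_ends[OF mem, unfolded branch_end_def subdivision_end_def, simplified]
    \<comment> \<open>Different index pairs therefore have different subdivision vertices.\<close>
    have uniq: "3 * i + j = 3 * k + l \<longleftrightarrow> i = k \<and> j = l" if "j < 3" "l < 3" for i j k l :: nat
      using that by presburger
    have ind: "set (\<pi> (c, i, j)) \<inter> set (\<pi> (d, k, l)) = {}"
      if "i < 3" "j < 3" "k < 3" "l < 3" "(i, j) \<noteq> (k, l)" "branch_end (c, i, j) \<noteq> branch_end (d, k, l)"
      for c d i j k l
      by (rule disj) (use that uniq in \<open>auto simp: independent_edges_def subdivision_end_def K33_edges_def\<close>)
    show False
      by (rule no_disjoint_subdivided_K33[of "\<lambda>i j. \<pi> (True, i, j)" "\<lambda>i j. \<pi> (False, i, j)" f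
            "\<lambda>j. f (3 + j)" "\<lambda>i j. f (6 + 3 * i + j)"])
        (use ends[of _ _ True] ends[of _ _ False] ind in \<open>auto simp: branch_end_def\<close>)
  qed
qed

text \<open>After exchanging the sums, a fixed pair of paths is counted once for each placement
  sending the ends of \<open>e\<close> and \<open>e'\<close> to its ends. This fixes four of the 15
  images up to orientation and leaves at most \<open>4 * card V ^ 11\<close> placements.\<close>

lemma sum_over_placements_le:
  fixes G :: "'a list \<Rightarrow> 'a list \<Rightarrow> real"
  assumes ee: "(e, e') \<in> independent_edges" and G: "\<And>p q. 0 \<le> G p q"
    and F: "F \<subseteq> {..<15} \<rightarrow>\<^sub>E V"
  shows "(\<Sum>f\<in>F. \<Sum>p\<in>joining (f (branch_end e)) (f (subdivision_end e)).
     \<Sum>q\<in>joining (f (branch_end e')) (f (subdivision_end e')). G p q)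
    \<le> 4 * real (card V) ^ 11 * (\<Sum>p\<in>paths_of V E. \<Sum>q\<in>paths_of V E. G p q)"
proof -
  let ?P = "paths_of V E"
  define R where "R = (\<lambda>(f :: nat \<Rightarrow> 'a) (p, q). {hd p, last p} = {f (branch_end e), f (subdivision_end e)}
    \<and> {hd q, last q} = {f (branch_end e'), f (subdivision_end e')})"
  have finP: "finite (?P \<times> ?P)" using finite_paths_of[OF fin] by simp
  have finE: "finite ({..<15::nat} \<rightarrow>\<^sub>E V)" using fin by (intro finite_PiE) auto
  then have finF: "finite F" using F finite_subset by blast
  have count: "card {f \<in> F. R f x} \<le> 4 * card V ^ 11" for x
  proof -
    obtain p q where x: "x = (p, q)" by (cases x)
    have E: "e \<in> K33_edges" "e' \<in> K33_edges" "branch_end e \<noteq> branch_end e'" "subdivision_end e \<noteq> subdivision_end e'"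
      using ee by (auto simp: independent_edges_def)
    note e = K33_edges_ends[OF E(1)] and e' = K33_edges_ends[OF E(2)]
    have "card {branch_end e, subdivision_end e, branch_end e', subdivision_end e'} = 4"
      using e e' E(3,4) by (simp add: card_insert_if)
    then have "card {f \<in> {..<15::nat} \<rightarrow>\<^sub>E V. R f x} \<le> 4 * card V ^ (card {..<15::nat} - 4)"
      unfolding R_def x prod.case
      by (intro card_funcset_two_edges_le) (use fin e e' in auto)
    moreover have "card {f \<in> F. R f x} \<le> card {f \<in> {..<15::nat} \<rightarrow>\<^sub>E V. R f x}"
      using finE F by (intro card_mono) auto
    ultimately show ?thesis by simp
  qed
  have "(\<Sum>f\<in>F. \<Sum>p\<in>joining (f (branch_end e)) (f (subdivision_end e)).
     \<Sum>q\<in>joining (f (branch_end e')) (f (subdivision_end e')). G p q)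
     = (\<Sum>f\<in>F. \<Sum>x\<in>{x \<in> ?P \<times> ?P. R f x}. case_prod G x)"
    by (intro sum.cong refl)
      (auto simp: sum.cartesian_product joining_def R_def intro!: sum.cong)
  also have "\<dots> = (\<Sum>x\<in>?P \<times> ?P. \<Sum>f\<in>{f \<in> F. R f x}. case_prod G x)"
    by (rule sum.swap_restrict[OF finF finP])
  also have "\<dots> = (\<Sum>x\<in>?P \<times> ?P. real (card {f \<in> F. R f x}) * case_prod G x)" by simp
  also have "\<dots> \<le> (\<Sum>x\<in>?P \<times> ?P. (4 * real (card V) ^ 11) * case_prod G x)"
  proof (intro sum_mono mult_right_mono)
    fix x show "real (card {f \<in> F. R f x}) \<le> 4 * real (card V) ^ 11"
      using of_nat_mono[OF count[of x], where 'a = real] by simp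
    show "0 \<le> case_prod G x" using G by (cases x) auto
  qed
  also have "\<dots> = 4 * real (card V) ^ 11 * (\<Sum>p\<in>?P. \<Sum>q\<in>?P. G p q)"
    by (simp add: sum.cartesian_product sum_distrib_left)
  finally show ?thesis .
qed

text \<open>Each injective placement contributes at least 1 to the expected number of meeting pairs.
  The constant is \<open>1296 = 324 * 4\<close>, from the pairs of edges and the
  orientations.\<close>

lemma card_injective_placements_le:
  "real (card {f \<in> {..<15} \<rightarrow>\<^sub>E V. inj_on f {..<15::nat}})
    \<le> 1296 * real (card V) ^ 11 * (\<Sum>w\<in>V. (vertex_flow V E r w)\<^sup>2)"
proof -
  let ?F = "{f \<in> {..<15} \<rightarrow>\<^sub>E V. inj_on f {..<15::nat}}"
  let ?G = "\<lambda>p q. r p * r q * of_bool (set p \<inter> set q \<noteq> {})"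
  let ?X = "\<Sum>p\<in>paths_of V E. \<Sum>q\<in>paths_of V E. ?G p q"
  let ?J = "\<lambda>f e. joining (f (branch_end e)) (f (subdivision_end e))"
  have G: "0 \<le> ?G p q" for p q using nonneg by simp
  then have X: "0 \<le> ?X" by (intro sum_nonneg)
  have "real (card ?F) = (\<Sum>f\<in>?F. 1)" by simp
  also have "\<dots> \<le> (\<Sum>f\<in>?F. \<Sum>(e, e')\<in>independent_edges. \<Sum>p\<in>?J f e. \<Sum>q\<in>?J f e'. ?G p q)"
    by (intro sum_mono crossing_in_random_K33) (auto simp: PiE_def)
  also have "\<dots> = (\<Sum>x\<in>independent_edges. \<Sum>f\<in>?F. \<Sum>p\<in>?J f (fst x). \<Sum>q\<in>?J f (snd x). ?G p q)"
    by (subst sum.swap) (simp add: case_prod_beta)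
  also have "\<dots> \<le> (\<Sum>x\<in>independent_edges. 4 * real (card V) ^ 11 * ?X)"
    by (intro sum_mono sum_over_placements_le) (use G in auto)
  also have "\<dots> = real (card independent_edges) * (4 * real (card V) ^ 11 * ?X)" by simp
  also have "\<dots> \<le> 324 * (4 * real (card V) ^ 11 * ?X)"
    using card_independent_edges(2) X by (intro mult_right_mono) auto
  also have "\<dots> = 1296 * real (card V) ^ 11 * ?X" by simp
  also have "\<dots> \<le> 1296 * real (card V) ^ 11 * (\<Sum>w\<in>V. (vertex_flow V E r w)\<^sup>2)"
    by (intro mult_left_mono sum_crossing_le_sum_flow_squared) auto
  finally show ?thesis .
qed

lemma max_vertex_flow_lower_bound:
  assumes "2 \<le> card V"
  shows "1 / 10000 * real (card V) powr (3/2) \<le> max_vertex_flow V E r"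
proof -
  define N where "N = real (card V)"
  define M where "M = max_vertex_flow V E r"
  have M: "1 \<le> M" unfolding M_def by (rule max_vertex_flow_ge_1[OF assms])
  have N: "2 \<le> N" unfolding N_def using assms by simp
  \<comment> \<open>From 28 vertices on, \<open>N - 14\<close> is at least \<open>N / 2\<close>.
    Below that, the flow is at least 1 while \<open>N powr (3/2)\<close> is below
    \<open>28 * 28 = 784\<close>, so the small constant suffices.\<close>
  show ?thesis
  proof (cases "card V < 28")
    case True
    have "N powr (3/2) \<le> N powr 2" using N by (intro powr_mono) auto
    also have "\<dots> = N\<^sup>2" using N by simp
    also have "\<dots> \<le> 28\<^sup>2" using True N by (intro power_mono) (auto simp: N_def)
    finally show ?thesis using M by (simp add: N_def M_def)
  next
    case False
    have "(\<Sum>w\<in>V. (vertex_flow V E r w)\<^sup>2) \<le> (\<Sum>w\<in>V. M\<^sup>2)"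
      unfolding M_def using vertex_flow_le_max vertex_flow_nonneg by (intro sum_mono power_mono) auto
    also have "\<dots> = N * M\<^sup>2" by (simp add: N_def)
    finally have S: "(\<Sum>w\<in>V. (vertex_flow V E r w)\<^sup>2) \<le> N * M\<^sup>2" .
    \<comment> \<open>The number of injective placements is a falling factorial with 15 factors, the
      smallest being \<open>card V - 14\<close>.\<close>
    have "(card V - 14) ^ 15 = (\<Prod>i\<in>{0..<15::nat}. card V - 14)" by simp
    also have "\<dots> \<le> (\<Prod>i\<in>{0..<15::nat}. card V - i)" by (intro prod_mono) auto
    also have "\<dots> = card {f \<in> {..<15} \<rightarrow>\<^sub>E V. inj_on f {..<15::nat}}"
      using card_inj_on_subset_funcset[of "{..<15::nat}" V "{..<15}"] fin by simp
    finally have "real ((card V - 14) ^ 15) \<le> real (card {f \<in> {..<15} \<rightarrow>\<^sub>E V. inj_on f {..<15::nat}})"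
      by (rule of_nat_mono)
    also have "\<dots> \<le> 1296 * N ^ 11 * (\<Sum>w\<in>V. (vertex_flow V E r w)\<^sup>2)"
      unfolding N_def by (rule card_injective_placements_le)
    also have "\<dots> \<le> 1296 * N ^ 11 * (N * M\<^sup>2)"
      using S N by (intro mult_left_mono) auto
    finally have "real ((card V - 14) ^ 15) \<le> 1296 * N ^ 11 * (N * M\<^sup>2)" .
    moreover have "(N / 2) ^ 15 \<le> real ((card V - 14) ^ 15)"
    proof -
      have "N / 2 \<le> real (card V - 14)" using False by (simp add: N_def of_nat_diff)
      then show ?thesis using N by (simp add: power_mono del: power_divide)
    qed
    ultimately have "(N / 2) ^ 15 \<le> 1296 * N ^ 11 * (N * M\<^sup>2)" by linarith
    \<comment> \<open>Here \<open>42467328 = 1296 * 2 ^ 15\<close>.\<close>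
    then have "N ^ 12 * N ^ 3 \<le> N ^ 12 * (42467328 * M\<^sup>2)"
      by (simp add: power_divide field_simps eval_nat_numeral)
    then have "N ^ 3 \<le> 42467328 * M\<^sup>2" by (rule mult_left_le_imp_le) (use N in simp)
    \<comment> \<open>Rounded up to the square of 10000, the origin of the constant
      \<open>1 / 10000\<close>.\<close>
    also have "\<dots> \<le> 100000000 * M\<^sup>2" by simp
    finally have N3: "N ^ 3 \<le> (10000 * M)\<^sup>2" by (simp add: power_mult_distrib)
    have "(N powr (3/2))\<^sup>2 = N powr 3"
      by (simp add: power2_eq_square flip: powr_add)
    also have "\<dots> = N ^ 3" using N by simp
    finally have "(N powr (3/2))\<^sup>2 \<le> (10000 * M)\<^sup>2" using N3 by simp
    then have "N powr (3/2) \<le> 10000 * M" by (rule power2_le_imp_le) (use M in simp)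
    then show ?thesis by (simp add: N_def M_def)
  qed
qed

end

text \<open>The condition \<open>2 \<le> card V\<close> excludes the graph with one vertex, where no
  paths exist and the flow is 0, so that no positive lower bound can hold.\<close>

theorem theorem2:
  shows "\<exists>c>0. \<forall>(V :: nat set) (E :: nat \<Rightarrow> nat \<Rightarrow> bool) (r :: nat list \<Rightarrow> real).
     simple_graph V E \<and> connected_graph V E \<and> planar_graph V E \<and> 2 \<le> card V
       \<and> routing V E r \<longrightarrow>
       c * real (card V) powr (3/2) \<le> max_vertex_flow V E r
       \<and> max_vertex_flow V E r \<le> real (card V) * (real (card V) - 1) / 2"
proof (intro exI[of _ "1 / 10000"] conjI allI impI)
  fix V :: "nat set" and E :: "nat \<Rightarrow> nat \<Rightarrow> bool" and r :: "nat list \<Rightarrow> real"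
  assume *: "simple_graph V E \<and> connected_graph V E \<and> planar_graph V E \<and> 2 \<le> card V \<and> routing V E r"
  then have fin: "finite V" and edge_in: "\<And>x y. E x y \<Longrightarrow> x \<in> V \<and> y \<in> V" and sym: "\<And>x y. E x y \<Longrightarrow> E y x"
    by (auto simp: simple_graph_def)
  from * have "planar_graph V E" by simp
  then obtain pos :: "nat \<Rightarrow> complex" and \<gamma> :: "nat \<Rightarrow> nat \<Rightarrow> real \<Rightarrow> complex" where inj: "inj_on pos V"
    and arcs: "\<forall>u v. E u v \<longrightarrow> arc (\<gamma> u v) \<and> pathstart (\<gamma> u v) = pos u \<and> pathfinish (\<gamma> u v) = pos v
                      \<and> \<gamma> v u = reversepath (\<gamma> u v)"
    and off: "\<forall>u v w. E u v \<and> w \<in> V \<and> w \<noteq> u \<and> w \<noteq> v \<longrightarrow> pos w \<notin> path_image (\<gamma> u v)"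
    and cross: "\<forall>u v x y. E u v \<and> E x y \<and> {u, v} \<noteq> {x, y} \<longrightarrow>
         path_image (\<gamma> u v) \<inter> path_image (\<gamma> x y) \<subseteq> pos ` ({u, v} \<inter> {x, y})"
    unfolding planar_graph_def by (elim exE conjE) (rule that)
  interpret routed_plane_graph V E pos \<gamma> r
  proof
    fix u v w x y
    show "E u v \<Longrightarrow> u \<in> V \<and> v \<in> V" "E u v \<Longrightarrow> E v u" by (fact edge_in, fact sym)
    show "E u v \<Longrightarrow> arc (\<gamma> u v) \<and> pathstart (\<gamma> u v) = pos u \<and> pathfinish (\<gamma> u v) = pos v"
      using arcs by simp
    show "E u v \<Longrightarrow> w \<in> V \<Longrightarrow> w \<noteq> u \<Longrightarrow> w \<noteq> v \<Longrightarrow> pos w \<notin> path_image (\<gamma> u v)"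
      using off by simp
    show "E u v \<Longrightarrow> E x y \<Longrightarrow> {u, v} \<noteq> {x, y} \<Longrightarrow>
        path_image (\<gamma> u v) \<inter> path_image (\<gamma> x y) \<subseteq> pos ` ({u, v} \<inter> {x, y})"
      using cross by simp
  qed (use * fin inj in simp_all)
  show "1 / 10000 * real (card V) powr (3/2) \<le> max_vertex_flow V E r"
    by (rule max_vertex_flow_lower_bound) (use * in simp)
  show "max_vertex_flow V E r \<le> real (card V) * (real (card V) - 1) / 2"
    by (rule max_vertex_flow_le) (use * in auto)
qed simp

end
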